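(* Let $\Omega\subset\mathbb{R}^2$ be a bounded domain with Lipschitz boundary, and let $\varphi_1,\varphi_2,\varphi_3$ be non-negative $C^{1,\alpha}$ functions on $\partial\Omega$ (for some $\alpha\in(0,1)$) with $\varphi_1\varphi_2\varphi_3=0$ on $\partial\Omega$. Then, as $\varepsilon\to 0^+$, the functionals $E^\varepsilon$ $\Gamma$-converge to $E^0$ in the (strong) $L^2(\Omega)^3$ topology, where $E^\varepsilon, E^0: L^2(\Omega)^3\to[0,+\infty]$ are the penalized and constrained energies with boundary data $\varphi_1,\varphi_2,\varphi_3$ defined in the context; in particular $$E^0(u_1,u_2,u_3)=\begin{cases}\displaystyle\int_\Omega\left(|\nabla u_1|^2+|\nabla u_2|^2+|\nabla u_3|^2\right)dx & \text{if }(u_1,u_2,u_3)\in S,\\ +\infty&\text{otherwise.}\end{cases}$$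
   Context: Boundary values are understood in the sense of traces of $H^1(\Omega)$ functions. Admissible class: $\mathcal{A}=\{(u_1,u_2,u_3)\in H^1(\Omega)^3: u_i\ge 0 \text{ a.e. in }\Omega,\ u_i|_{\partial\Omega}=\varphi_i,\ i=1,2,3\}$. Constraint set (partial segregation): $S=\{(u_1,u_2,u_3)\in\mathcal{A}: u_1u_2u_3=0 \text{ a.e. in }\Omega\}$. Penalized energy: for $\varepsilon>0$, $$E^\varepsilon(u_1,u_2,u_3)=\int_\Omega\left[\sum_{i=1}^3|\nabla u_i|^2+\frac1\varepsilon (u_1u_2u_3)^2\right]dx\quad\text{if }(u_1,u_2,u_3)\in\mathcal{A},$$ and $E^\varepsilon(u_1,u_2,u_3)=+\infty$ for all other $(u_1,u_2,u_3)\in L^2(\Omega)^3$. $\Gamma$-convergence of $E^\varepsilon$ to $E^0$ in $L^2(\Omega)^3$ as $\varepsilon\to0^+$ means that for every sequence $\varepsilon_n\to 0^+$ and every $u\in L^2(\Omega)^3$: (i) for every sequence $u^n\to u$ in $L^2(\Omega)^3$, $\liminf_n E^{\varepsilon_n}(u^n)\ge E^0(u)$; (ii) there is a sequence $u^n\to u$ in $L^2(\Omega)^3$ with $\limsup_n E^{\varepsilon_n}(u^n)\le E^0(u)$. *)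

theory Defs
  imports "HOL-Analysis.Analysis"
begin

type_synonym plane = "real ^ 2"

section \<open>One-dimensional Hausdorff measure\<close>

definition hausdorff_cover :: "real \<Rightarrow> 'a::metric_space set \<Rightarrow> (nat \<Rightarrow> 'a set) set" where
  "hausdorff_cover \<delta> A =
     {C. A \<subseteq> (\<Union>i. C i) \<and> (\<forall>i. bounded (C i) \<and> diameter (C i) \<le> \<delta>)}"

definition hausdorff_pre :: "real \<Rightarrow> 'a::metric_space set \<Rightarrow> ennreal" where
  "hausdorff_pre \<delta> A = (INF C\<in>hausdorff_cover \<delta> A. \<Sum>i. ennreal (diameter (C i)))"

definition hausdorff_outer :: "'a::metric_space set \<Rightarrow> ennreal" where
  "hausdorff_outer A = (SUP \<delta>\<in>{0<..}. hausdorff_pre \<delta> A)"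

text \<open>
  \<open>measure_of\<close> returns the null measure when its argument is not countably additive on the given
  sets; \<open>emeasure_hausdorff_measure\<close> at the end of this theory shows that this does not happen.
\<close>

definition hausdorff_measure :: "'a::metric_space measure" where
  "hausdorff_measure = measure_of UNIV (sets borel) hausdorff_outer"

section \<open>Lipschitz domains and boundary data\<close>

definition lipschitz_boundary :: "plane set \<Rightarrow> bool" where
  "lipschitz_boundary \<Omega> \<longleftrightarrow>
     (\<forall>p\<in>frontier \<Omega>. \<exists>r>0. \<exists>T \<gamma> L.
        orthogonal_transformation (T :: plane \<Rightarrow> plane) \<and> L-lipschitz_on UNIV (\<gamma> :: real \<Rightarrow> real) \<and>
        (\<forall>x\<in>ball p r. x \<in> \<Omega> \<longleftrightarrow> \<gamma> (T x $ 1) < T x $ 2))"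

definition lipschitz_domain :: "plane set \<Rightarrow> bool" where
  "lipschitz_domain \<Omega> \<longleftrightarrow>
     \<Omega> \<noteq> {} \<and> open \<Omega> \<and> connected \<Omega> \<and> bounded \<Omega> \<and> lipschitz_boundary \<Omega>"

text \<open>
  On a boundary that is only Lipschitz, \<open>C\<^bsup>1,\<alpha>\<^esup>\<close> cannot be read off in boundary charts; it means
  being the restriction of a \<open>C\<^bsup>1,\<alpha>\<^esup>\<close> function of the plane.
\<close>

definition C1_holder_on :: "real \<Rightarrow> plane set \<Rightarrow> (plane \<Rightarrow> real) \<Rightarrow> bool" where
  "C1_holder_on \<alpha> S \<phi> \<longleftrightarrow>
     (\<exists>\<Phi> G C. (\<forall>x. (\<Phi> has_derivative (\<lambda>h. G x \<bullet> h)) (at x)) \<and>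
        (\<forall>x y. norm (G x - G y) \<le> C * dist x y powr \<alpha>) \<and>
        (\<forall>x\<in>S. \<Phi> x = \<phi> x))"

section \<open>The Sobolev space \<open>H\<^sup>1\<close>\<close>

text \<open>
  Elements of \<open>L\<^sup>2\<close> and \<open>H\<^sup>1\<close> are represented by functions; membership, norms, traces and
  energies do not change when such a function is modified on a null set.
\<close>

definition L2 :: "plane set \<Rightarrow> (plane \<Rightarrow> 'b::euclidean_space) set" where
  "L2 \<Omega> = {f \<in> borel_measurable (lebesgue_on \<Omega>). integrable (lebesgue_on \<Omega>) (\<lambda>x. (norm (f x))\<^sup>2)}"

definition L2_norm :: "plane set \<Rightarrow> (plane \<Rightarrow> 'b::euclidean_space) \<Rightarrow> real" where
  "L2_norm \<Omega> f = sqrt (\<integral>x. (norm (f x))\<^sup>2 \<partial>lebesgue_on \<Omega>)"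

definition partial_deriv :: "2 \<Rightarrow> (plane \<Rightarrow> real) \<Rightarrow> plane \<Rightarrow> real" where
  "partial_deriv j f x = frechet_derivative f (at x) (axis j 1)"

primrec Ck :: "nat \<Rightarrow> (plane \<Rightarrow> real) \<Rightarrow> bool" where
  "Ck 0 f \<longleftrightarrow> continuous_on UNIV f"
| "Ck (Suc k) f \<longleftrightarrow> f differentiable_on UNIV \<and> (\<forall>j. Ck k (partial_deriv j f))"

definition test_function :: "plane set \<Rightarrow> (plane \<Rightarrow> real) \<Rightarrow> bool" where
  "test_function \<Omega> \<psi> \<longleftrightarrow>
     (\<forall>k. Ck k \<psi>) \<and> compact (closure {x. \<psi> x \<noteq> 0}) \<and> closure {x. \<psi> x \<noteq> 0} \<subseteq> \<Omega>"

definition has_weak_gradient :: "plane set \<Rightarrow> (plane \<Rightarrow> real) \<Rightarrow> (plane \<Rightarrow> plane) \<Rightarrow> bool" where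
  "has_weak_gradient \<Omega> u g \<longleftrightarrow> g \<in> L2 \<Omega> \<and>
     (\<forall>\<psi> j. test_function \<Omega> \<psi> \<longrightarrow>
        (\<integral>x. u x * partial_deriv j \<psi> x \<partial>lebesgue_on \<Omega>) = - (\<integral>x. g x $ j * \<psi> x \<partial>lebesgue_on \<Omega>))"

definition H1 :: "plane set \<Rightarrow> (plane \<Rightarrow> real) set" where
  "H1 \<Omega> = {u \<in> L2 \<Omega>. \<exists>g. has_weak_gradient \<Omega> u g}"

text \<open>Weak gradients are unique up to null sets, so integrals do not depend on the choice.\<close>

definition weak_gradient :: "plane set \<Rightarrow> (plane \<Rightarrow> real) \<Rightarrow> plane \<Rightarrow> plane" where
  "weak_gradient \<Omega> u = (SOME g. has_weak_gradient \<Omega> u g)"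

definition H1_norm :: "plane set \<Rightarrow> (plane \<Rightarrow> real) \<Rightarrow> real" where
  "H1_norm \<Omega> u = sqrt ((L2_norm \<Omega> u)\<^sup>2 + (L2_norm \<Omega> (weak_gradient \<Omega> u))\<^sup>2)"

text \<open>
  The trace operator is the continuous extension, from \<open>H\<^sup>1(\<Omega>)\<close> to \<open>L\<^sup>2(\<partial>\<Omega>)\<close>, of the restriction of
  functions in \<open>H\<^sup>1(\<Omega>) \<inter> C(closure \<Omega>)\<close> to \<open>\<partial>\<Omega>\<close>: the trace of \<open>u\<close> is the \<open>L\<^sup>2(\<partial>\<Omega>)\<close> limit of \<open>v k\<close> along
  any such approximating sequence.
\<close>

definition has_trace :: "plane set \<Rightarrow> (plane \<Rightarrow> real) \<Rightarrow> (plane \<Rightarrow> real) \<Rightarrow> bool" where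
  "has_trace \<Omega> u \<phi> \<longleftrightarrow> u \<in> H1 \<Omega> \<and>
     (\<exists>v :: nat \<Rightarrow> plane \<Rightarrow> real.
        (\<forall>k. v k \<in> H1 \<Omega> \<and> continuous_on (closure \<Omega>) (v k)) \<and>
        (\<lambda>k. H1_norm \<Omega> (\<lambda>x. v k x - u x)) \<longlonglongrightarrow> 0 \<and>
        (\<lambda>k. \<integral>\<^sup>+x\<in>frontier \<Omega>. ennreal ((v k x - \<phi> x)\<^sup>2) \<partial>hausdorff_measure) \<longlonglongrightarrow> 0)"

section \<open>Energies\<close>

text \<open>Triples are indexed by the three-element type \<open>3\<close>.\<close>

definition admissible :: "plane set \<Rightarrow> (3 \<Rightarrow> plane \<Rightarrow> real) \<Rightarrow> (3 \<Rightarrow> plane \<Rightarrow> real) set" where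
  "admissible \<Omega> \<phi> =
     {u. \<forall>i. u i \<in> H1 \<Omega> \<and> (AE x in lebesgue_on \<Omega>. 0 \<le> u i x) \<and> has_trace \<Omega> (u i) (\<phi> i)}"

definition segregated :: "plane set \<Rightarrow> (3 \<Rightarrow> plane \<Rightarrow> real) \<Rightarrow> (3 \<Rightarrow> plane \<Rightarrow> real) set" where
  "segregated \<Omega> \<phi> = {u \<in> admissible \<Omega> \<phi>. AE x in lebesgue_on \<Omega>. (\<Prod>i\<in>UNIV. u i x) = 0}"

definition penalized_energy ::
    "plane set \<Rightarrow> (3 \<Rightarrow> plane \<Rightarrow> real) \<Rightarrow> real \<Rightarrow> (3 \<Rightarrow> plane \<Rightarrow> real) \<Rightarrow> ennreal" where
  "penalized_energy \<Omega> \<phi> \<epsilon> u =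
     (if u \<in> admissible \<Omega> \<phi>
      then \<integral>\<^sup>+x. ennreal ((\<Sum>i\<in>UNIV. (norm (weak_gradient \<Omega> (u i) x))\<^sup>2) + 1 / \<epsilon> * (\<Prod>i\<in>UNIV. u i x)\<^sup>2)
             \<partial>lebesgue_on \<Omega>
      else \<infinity>)"

definition constrained_energy ::
    "plane set \<Rightarrow> (3 \<Rightarrow> plane \<Rightarrow> real) \<Rightarrow> (3 \<Rightarrow> plane \<Rightarrow> real) \<Rightarrow> ennreal" where
  "constrained_energy \<Omega> \<phi> u =
     (if u \<in> segregated \<Omega> \<phi>
      then \<integral>\<^sup>+x. ennreal (\<Sum>i\<in>UNIV. (norm (weak_gradient \<Omega> (u i) x))\<^sup>2) \<partial>lebesgue_on \<Omega>
      else \<infinity>)"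

section \<open>\<open>\<Gamma>\<close>-convergence in \<open>L\<^sup>2(\<Omega>)\<^sup>3\<close>\<close>

definition L2_tendsto ::
    "plane set \<Rightarrow> (nat \<Rightarrow> 3 \<Rightarrow> plane \<Rightarrow> real) \<Rightarrow> (3 \<Rightarrow> plane \<Rightarrow> real) \<Rightarrow> bool" where
  "L2_tendsto \<Omega> w u \<longleftrightarrow> (\<forall>i. (\<lambda>n. L2_norm \<Omega> (\<lambda>x. w n i x - u i x)) \<longlonglongrightarrow> 0)"

definition Gamma_converges ::
    "plane set \<Rightarrow> (real \<Rightarrow> (3 \<Rightarrow> plane \<Rightarrow> real) \<Rightarrow> ennreal) \<Rightarrow>
     ((3 \<Rightarrow> plane \<Rightarrow> real) \<Rightarrow> ennreal) \<Rightarrow> bool" where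
  "Gamma_converges \<Omega> E E0 \<longleftrightarrow>
     (\<forall>\<epsilon> :: nat \<Rightarrow> real. (\<forall>n. 0 < \<epsilon> n) \<longrightarrow> \<epsilon> \<longlonglongrightarrow> 0 \<longrightarrow>
        (\<forall>u. (\<forall>i. u i \<in> L2 \<Omega>) \<longrightarrow>
           (\<forall>w. (\<forall>n i. w n i \<in> L2 \<Omega>) \<longrightarrow> L2_tendsto \<Omega> w u \<longrightarrow>
              E0 u \<le> liminf (\<lambda>n. E (\<epsilon> n) (w n))) \<and>
           (\<exists>w. (\<forall>n i. w n i \<in> L2 \<Omega>) \<and> L2_tendsto \<Omega> w u \<and>
              limsup (\<lambda>n. E (\<epsilon> n) (w n)) \<le> E0 u)))"

section \<open>The Hausdorff measure is a measure on the Borel sets\<close>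

lemma hausdorff_pre_antimono:
  assumes "\<delta> \<le> \<delta>'"
  shows "hausdorff_pre \<delta>' A \<le> hausdorff_pre \<delta> A"
  unfolding hausdorff_pre_def
  by (rule INF_superset_mono) (auto simp: hausdorff_cover_def intro: order_trans[OF _ assms])

lemma hausdorff_pre_mono:
  assumes "A \<subseteq> B"
  shows "hausdorff_pre \<delta> A \<le> hausdorff_pre \<delta> B"
  unfolding hausdorff_pre_def
  by (rule INF_superset_mono) (use assms in \<open>auto simp: hausdorff_cover_def\<close>)

lemma hausdorff_pre_le_outer: "0 < \<delta> \<Longrightarrow> hausdorff_pre \<delta> A \<le> hausdorff_outer A"
  unfolding hausdorff_outer_def by (rule SUP_upper) auto

lemma hausdorff_outer_mono: "A \<subseteq> B \<Longrightarrow> hausdorff_outer A \<le> hausdorff_outer B"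
  unfolding hausdorff_outer_def by (rule SUP_mono) (use hausdorff_pre_mono in blast)

lemma hausdorff_outer_empty [simp]: "hausdorff_outer {} = 0"
proof -
  have "hausdorff_pre \<delta> ({} :: 'a set) \<le> 0" if "0 < \<delta>" for \<delta>
    unfolding hausdorff_pre_def
    by (rule INF_lower2[where i = "\<lambda>_. {}"]) (use that in \<open>auto simp: hausdorff_cover_def\<close>)
  then show ?thesis
    unfolding hausdorff_outer_def by (simp add: bot_ennreal)
qed

lemma hausdorff_pre_UN:
  fixes A :: "nat \<Rightarrow> 'a::metric_space set"
  shows "hausdorff_pre \<delta> (\<Union>n. A n) \<le> (\<Sum>n. hausdorff_pre \<delta> (A n))"
proof (cases "(\<Sum>n. hausdorff_pre \<delta> (A n)) = \<infinity>")
  case False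
  then have fin: "hausdorff_pre \<delta> (A n) \<noteq> \<infinity>" for n
    by (metis ennreal_suminf_lessD infinity_ennreal_def top.not_eq_extremum)
  show ?thesis
  proof (rule ennreal_le_epsilon)
    fix e :: real assume e: "0 < e"
    have "\<exists>C\<in>hausdorff_cover \<delta> (A n).
        (\<Sum>i. ennreal (diameter (C i))) \<le> hausdorff_pre \<delta> (A n) + ennreal (e * (1/2) ^ Suc n)" for n
    proof -
      have "hausdorff_pre \<delta> (A n) < hausdorff_pre \<delta> (A n) + ennreal (e * (1/2) ^ Suc n)"
        using fin[of n] e by (simp add: ennreal_add_left_cancel_less less_top)
      then show ?thesis
        unfolding hausdorff_pre_def INF_less_iff by (auto intro: less_imp_le)
    qed
    then obtain C where C: "\<And>n. C n \<in> hausdorff_cover \<delta> (A n)"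
      "\<And>n. (\<Sum>i. ennreal (diameter (C n i))) \<le> hausdorff_pre \<delta> (A n) + ennreal (e * (1/2) ^ Suc n)"
      by metis
    define D where "D p = C (fst (prod_decode p)) (snd (prod_decode p))" for p
    have "D \<in> hausdorff_cover \<delta> (\<Union>n. A n)"
    proof -
      have "x \<in> (\<Union>p. D p)" if x: "x \<in> A n" for x n
      proof -
        obtain i where "x \<in> C n i"
          using C(1)[of n] x unfolding hausdorff_cover_def by blast
        then have "x \<in> D (prod_encode (n, i))"
          by (simp add: D_def)
        then show ?thesis by blast
      qed
      then show ?thesis
        using C(1) by (auto simp: hausdorff_cover_def D_def)
    qed
    then have "hausdorff_pre \<delta> (\<Union>n. A n) \<le> (\<Sum>p. ennreal (diameter (D p)))"
      unfolding hausdorff_pre_def by (rule INF_lower)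
    also have "\<dots> = (\<Sum>n. \<Sum>i. ennreal (diameter (C n i)))"
      using suminf_ennreal_2dimen[of "\<lambda>n. \<Sum>i. ennreal (diameter (C n i))"
          "\<lambda>p. ennreal (diameter (C (fst p) (snd p)))"]
      by (simp add: D_def)
    also have "\<dots> \<le> (\<Sum>n. hausdorff_pre \<delta> (A n) + ennreal (e * (1/2) ^ Suc n))"
      by (intro suminf_le C summableI)
    also have "\<dots> = (\<Sum>n. hausdorff_pre \<delta> (A n)) + (\<Sum>n. ennreal (e * (1/2) ^ Suc n))"
      by (intro suminf_add[symmetric] summableI)
    also have "(\<Sum>n. ennreal (e * (1/2) ^ Suc n)) = ennreal e"
      using sums_mult[OF power_half_series, of e] e by (intro suminf_ennreal_eq) auto
    finally show "hausdorff_pre \<delta> (\<Union>n. A n) \<le> (\<Sum>n. hausdorff_pre \<delta> (A n)) + ennreal e" .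
  qed
qed simp

lemma hausdorff_outer_UN:
  fixes A :: "nat \<Rightarrow> 'a::metric_space set"
  shows "hausdorff_outer (\<Union>n. A n) \<le> (\<Sum>n. hausdorff_outer (A n))"
  unfolding hausdorff_outer_def[of "\<Union>n. A n"]
proof (rule SUP_least)
  fix \<delta> :: real assume "\<delta> \<in> {0<..}"
  then have "(\<Sum>n. hausdorff_pre \<delta> (A n)) \<le> (\<Sum>n. hausdorff_outer (A n))"
    by (intro suminf_le summableI hausdorff_pre_le_outer) auto
  then show "hausdorff_pre \<delta> (\<Union>n. A n) \<le> (\<Sum>n. hausdorff_outer (A n))"
    using hausdorff_pre_UN order_trans by blast
qed

lemma hausdorff_outer_Un: "hausdorff_outer (A \<union> B) \<le> hausdorff_outer A + hausdorff_outer B"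
proof -
  have "(\<Union>n. if n = (0::nat) then A else if n = 1 then B else {}) = A \<union> B"
    by (auto split: if_splits intro: exI[of _ 0] exI[of _ "Suc 0"])
  then have "hausdorff_outer (A \<union> B) \<le>
      (\<Sum>n. hausdorff_outer (if n = (0::nat) then A else if n = 1 then B else {}))"
    using hausdorff_outer_UN[of "\<lambda>n. if n = (0::nat) then A else if n = 1 then B else {}"] by simp
  also have "\<dots> = (\<Sum>n\<in>{0,1}. hausdorff_outer (if n = (0::nat) then A else if n = 1 then B else {}))"
    by (rule suminf_finite) auto
  finally show ?thesis by simp
qed

lemma hausdorff_outer_metric:
  assumes d: "0 < d" and sep: "\<And>x y. x \<in> A \<Longrightarrow> y \<in> B \<Longrightarrow> d \<le> dist x y"
  shows "hausdorff_outer A + hausdorff_outer B \<le> hausdorff_outer (A \<union> B)"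
proof -
  have pre: "hausdorff_pre \<delta> A + hausdorff_pre \<delta> B \<le> hausdorff_pre \<delta> (A \<union> B)"
    if \<delta>: "0 < \<delta>" "\<delta> < d" for \<delta>
    unfolding hausdorff_pre_def[of \<delta> "A \<union> B"]
  proof (rule INF_greatest)
    fix C assume C: "C \<in> hausdorff_cover \<delta> (A \<union> B)"
    define CA where "CA i = (if C i \<inter> A \<noteq> {} then C i else {})" for i
    define CB where "CB i = (if C i \<inter> B \<noteq> {} then C i else {})" for i
    have excl: "C i \<inter> A = {} \<or> C i \<inter> B = {}" for i
    proof (rule ccontr)
      assume "\<not> ?thesis"
      then obtain x y where xy: "x \<in> C i" "x \<in> A" "y \<in> C i" "y \<in> B" by blast
      then have "dist x y \<le> diameter (C i)"
        using C by (intro diameter_bounded_bound) (auto simp: hausdorff_cover_def)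
      also have "\<dots> \<le> \<delta>" using C by (auto simp: hausdorff_cover_def)
      finally show False using sep[OF xy(2,4)] \<delta> by simp
    qed
    have "CA \<in> hausdorff_cover \<delta> A"
      using C \<delta> by (fastforce simp: hausdorff_cover_def CA_def)
    then have 1: "hausdorff_pre \<delta> A \<le> (\<Sum>i. ennreal (diameter (CA i)))"
      unfolding hausdorff_pre_def by (rule INF_lower)
    have "CB \<in> hausdorff_cover \<delta> B"
      using C \<delta> by (fastforce simp: hausdorff_cover_def CB_def)
    then have 2: "hausdorff_pre \<delta> B \<le> (\<Sum>i. ennreal (diameter (CB i)))"
      unfolding hausdorff_pre_def by (rule INF_lower)
    have "hausdorff_pre \<delta> A + hausdorff_pre \<delta> B
        \<le> (\<Sum>i. ennreal (diameter (CA i))) + (\<Sum>i. ennreal (diameter (CB i)))"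
      by (rule add_mono[OF 1 2])
    also have "\<dots> = (\<Sum>i. ennreal (diameter (CA i)) + ennreal (diameter (CB i)))"
      by (intro suminf_add summableI)
    also have "\<dots> \<le> (\<Sum>i. ennreal (diameter (C i)))"
      by (intro suminf_le summableI) (use excl in \<open>auto simp: CA_def CB_def\<close>)
    finally show "hausdorff_pre \<delta> A + hausdorff_pre \<delta> B \<le> (\<Sum>i. ennreal (diameter (C i)))" .
  qed
  have "(SUP \<delta>\<in>{0<..}. hausdorff_pre \<delta> A) + (SUP \<delta>\<in>{0<..}. hausdorff_pre \<delta> B)
      = (SUP \<delta>\<in>{0<..}. hausdorff_pre \<delta> A + hausdorff_pre \<delta> B)"
  proof (rule SUP_add_directed_ennreal[symmetric])
    fix \<delta> \<delta>' :: real assume "\<delta> \<in> {0<..}" "\<delta>' \<in> {0<..}"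
    then show "\<exists>\<eta>\<in>{0<..}. hausdorff_pre \<delta> A + hausdorff_pre \<delta>' B
        \<le> hausdorff_pre \<eta> A + hausdorff_pre \<eta> B"
      by (intro bexI[of _ "min \<delta> \<delta>'"] add_mono hausdorff_pre_antimono) auto
  qed
  also have "\<dots> \<le> hausdorff_outer (A \<union> B)"
  proof (rule SUP_least)
    fix \<delta> :: real assume "\<delta> \<in> {0<..}"
    then have \<eta>: "0 < min \<delta> (d / 2)" "min \<delta> (d / 2) < d"
      using d by auto
    have "hausdorff_pre \<delta> A + hausdorff_pre \<delta> B
        \<le> hausdorff_pre (min \<delta> (d / 2)) A + hausdorff_pre (min \<delta> (d / 2)) B"
      by (intro add_mono hausdorff_pre_antimono) auto
    also have "\<dots> \<le> hausdorff_pre (min \<delta> (d / 2)) (A \<union> B)" by (rule pre[OF \<eta>])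
    also have "\<dots> \<le> hausdorff_outer (A \<union> B)" by (rule hausdorff_pre_le_outer[OF \<eta>(1)])
    finally show "hausdorff_pre \<delta> A + hausdorff_pre \<delta> B \<le> hausdorff_outer (A \<union> B)" .
  qed
  finally show ?thesis
    unfolding hausdorff_outer_def[of A] hausdorff_outer_def[of B] .
qed

lemma hausdorff_outer_level_sets:
  assumes "t < s" "\<And>x. x \<in> A \<Longrightarrow> s \<le> infdist x F" "\<And>x. x \<in> B \<Longrightarrow> infdist x F \<le> t"
  shows "hausdorff_outer A + hausdorff_outer B \<le> hausdorff_outer (A \<union> B)"
proof (rule hausdorff_outer_metric[of "s - t"])
  fix x y assume "x \<in> A" "y \<in> B"
  then have "s \<le> infdist x F" "infdist y F \<le> t" using assms by auto
  moreover have "\<bar>infdist x F - infdist y F\<bar> \<le> dist x y" by (rule infdist_triangle_abs)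
  ultimately show "s - t \<le> dist x y" by linarith
qed (use assms in simp)

lemma hausdorff_outer_closed:
  fixes F X :: "'a::metric_space set"
  assumes F: "closed F"
  shows "hausdorff_outer (X \<inter> F) + hausdorff_outer (X - F) \<le> hausdorff_outer X"
proof (cases "F = {} \<or> hausdorff_outer X = \<infinity>")
  case False
  then have ne: "F \<noteq> {}" and fin: "hausdorff_outer X \<noteq> \<infinity>" by auto
  define A where "A n = {x \<in> X. 1 / (real n + 1) \<le> infdist x F}" for n
  define R where "R n = A (Suc n) - A n" for n
  have A_sub: "A n \<subseteq> X" for n by (auto simp: A_def)
  have R_sub: "R n \<subseteq> X" for n using A_sub by (auto simp: R_def)
  have R_lo: "1 / (real n + 2) \<le> infdist x F" and R_hi: "infdist x F \<le> 1 / (real n + 1)"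
    if "x \<in> R n" for x n
    using that by (auto simp: R_def A_def add.commute)
  have half: "(\<Sum>k<m. hausdorff_outer (R (2 * k + j))) \<le> hausdorff_outer (\<Union>k<m. R (2 * k + j))"
    for m j
  proof (induction m)
    case (Suc m)
    have "(\<Sum>k<Suc m. hausdorff_outer (R (2 * k + j)))
        \<le> hausdorff_outer (\<Union>k<m. R (2 * k + j)) + hausdorff_outer (R (2 * m + j))"
      using Suc by (simp add: add_right_mono)
    also have "\<dots> \<le> hausdorff_outer ((\<Union>k<m. R (2 * k + j)) \<union> R (2 * m + j))"
    proof (cases "m = 0")
      case False
      show ?thesis
      proof (rule hausdorff_outer_level_sets[where F = F
            and t = "1 / (real (2 * m + j) + 1)" and s = "1 / real (2 * m + j)"])
        show "1 / (real (2 * m + j) + 1) < 1 / real (2 * m + j)"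
          using False by (intro divide_strict_left_mono) auto
        show "infdist x F \<le> 1 / (real (2 * m + j) + 1)" if "x \<in> R (2 * m + j)" for x
          using R_hi[OF that] .
        fix x assume "x \<in> (\<Union>k<m. R (2 * k + j))"
        then obtain k where k: "k < m" "x \<in> R (2 * k + j)" by auto
        have "1 / real (2 * m + j) \<le> 1 / (real (2 * k + j) + 2)"
          using k(1) by (intro divide_left_mono) auto
        then show "1 / real (2 * m + j) \<le> infdist x F"
          using R_lo[OF k(2)] by linarith
      qed
    qed simp
    also have "(\<Union>k<m. R (2 * k + j)) \<union> R (2 * m + j) = (\<Union>k<Suc m. R (2 * k + j))"
      by (auto simp: lessThan_Suc)
    finally show ?case .
  qed simp
  have half': "(\<Sum>k<m. hausdorff_outer (R (2 * k + j))) \<le> hausdorff_outer X" for m j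
    by (rule order_trans[OF half hausdorff_outer_mono]) (use R_sub in blast)
  have split: "(\<Sum>k<2 * m. f k) = (\<Sum>k<m. f (2 * k + 0)) + (\<Sum>k<m. f (2 * k + 1))"
    for m and f :: "nat \<Rightarrow> ennreal"
    by (induction m) (simp_all add: algebra_simps)
  define f where "f k = hausdorff_outer (R k)" for k
  have "(\<Sum>k. f k) \<le> hausdorff_outer X + hausdorff_outer X"
  proof (rule suminf_le_const[OF summableI])
    fix n
    have "(\<Sum>k<n. f k) \<le> (\<Sum>k<2 * n. f k)"
      by (rule sum_mono2) auto
    also have "\<dots> \<le> hausdorff_outer X + hausdorff_outer X"
      unfolding split f_def by (intro add_mono half')
    finally show "(\<Sum>k<n. f k) \<le> hausdorff_outer X + hausdorff_outer X" .
  qed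
  then have sfin: "(\<Sum>k. f k) \<noteq> \<infinity>"
    using fin by (metis ennreal_add_eq_top infinity_ennreal_def neq_top_trans)
  have tail: "hausdorff_outer (X \<inter> F) + hausdorff_outer (X - F)
      \<le> hausdorff_outer X + ((\<Sum>k. f k) - (\<Sum>k<n. f k))" for n
  proof -
    have "x \<in> A n \<union> (\<Union>k. R (k + n))" if "x \<in> X - F" for x
    proof -
      have "0 < infdist x F"
        using that F ne by (metis DiffD2 in_closed_iff_infdist_zero infdist_nonneg less_eq_real_def)
      then obtain m where "inverse (real (Suc m)) < infdist x F"
        using reals_Archimedean by blast
      then have ex: "x \<in> A m"
        using that by (auto simp: A_def inverse_eq_divide add.commute)
      define l where "l = (LEAST m. x \<in> A m)"
      have l: "x \<in> A l" unfolding l_def using ex by (rule LeastI)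
      have mono: "A i \<subseteq> A i'" if "i \<le> i'" for i i'
      proof -
        have "1 / (real i' + 1) \<le> 1 / (real i + 1)"
          using that by (intro divide_left_mono) auto
        then show ?thesis unfolding A_def by auto
      qed
      show ?thesis
      proof (cases "l \<le> n")
        case True
        then show ?thesis using l mono by blast
      next
        case False
        then obtain k where k: "l = Suc (k + n)"
          by (metis add.commute less_imp_Suc_add not_le)
        have "x \<notin> A (k + n)"
          using not_less_Least[of "k + n" "\<lambda>m. x \<in> A m"] k unfolding l_def by simp
        then have "x \<in> R (k + n)"
          using l k by (simp add: R_def)
        then show ?thesis by blast
      qed
    qed
    then have "hausdorff_outer (X - F) \<le> hausdorff_outer (A n \<union> (\<Union>k. R (k + n)))"
      by (intro hausdorff_outer_mono) blast
    also have "\<dots> \<le> hausdorff_outer (A n) + (\<Sum>k. f (k + n))"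
      unfolding f_def by (rule order_trans[OF hausdorff_outer_Un]) (intro add_left_mono hausdorff_outer_UN)
    also have "(\<Sum>k. f (k + n)) = (\<Sum>k. f k) - (\<Sum>k<n. f k)"
    proof -
      have "(\<Sum>k<n. f k) \<le> (\<Sum>k. f k)"
        by (intro sum_le_suminf summableI) auto
      then have "(\<Sum>k<n. f k) \<noteq> \<infinity>"
        using sfin by (metis infinity_ennreal_def neq_top_trans)
      moreover have "(\<Sum>k. f k) = (\<Sum>k. f (k + n)) + (\<Sum>k<n. f k)"
        by (intro suminf_offset summableI)
      ultimately show ?thesis
        by (simp add: ennreal_add_diff_cancel_right)
    qed
    finally have 1: "hausdorff_outer (X - F) \<le> hausdorff_outer (A n) + ((\<Sum>k. f k) - (\<Sum>k<n. f k))" .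
    have "hausdorff_outer (A n) + hausdorff_outer (X \<inter> F) \<le> hausdorff_outer (A n \<union> (X \<inter> F))"
      by (rule hausdorff_outer_level_sets[where F = F and t = 0 and s = "1 / (real n + 1)"])
        (auto simp: A_def)
    also have "\<dots> \<le> hausdorff_outer X"
      by (rule hausdorff_outer_mono) (use A_sub in blast)
    finally have 2: "hausdorff_outer (A n) + hausdorff_outer (X \<inter> F) \<le> hausdorff_outer X" .
    have "hausdorff_outer (X \<inter> F) + hausdorff_outer (X - F)
        \<le> (hausdorff_outer (A n) + hausdorff_outer (X \<inter> F)) + ((\<Sum>k. f k) - (\<Sum>k<n. f k))"
      using add_left_mono[OF 1, of "hausdorff_outer (X \<inter> F)"] by (simp add: ac_simps)
    also have "\<dots> \<le> hausdorff_outer X + ((\<Sum>k. f k) - (\<Sum>k<n. f k))"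
      by (rule add_right_mono[OF 2])
    finally show ?thesis .
  qed
  have "(\<lambda>n. \<Sum>k<n. f k) \<longlonglongrightarrow> (\<Sum>k. f k)"
    by (intro summable_LIMSEQ summableI)
  then have "(\<lambda>n. (\<Sum>k. f k) - (\<Sum>k<n. f k)) \<longlonglongrightarrow> (\<Sum>k. f k) - (\<Sum>k. f k)"
    using sfin by (intro tendsto_diff_ennreal tendsto_const) auto
  then have "(\<lambda>n. hausdorff_outer X + ((\<Sum>k. f k) - (\<Sum>k<n. f k)))
      \<longlonglongrightarrow> hausdorff_outer X + ((\<Sum>k. f k) - (\<Sum>k. f k))"
    by (intro tendsto_add tendsto_const)
  then have "hausdorff_outer (X \<inter> F) + hausdorff_outer (X - F)
      \<le> hausdorff_outer X + ((\<Sum>k. f k) - (\<Sum>k. f k))"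
    by (rule Lim_bounded2) (use tail in auto)
  then show ?thesis using sfin by simp
qed auto

lemma measure_space_hausdorff: "measure_space UNIV (sets borel) hausdorff_outer"
proof -
  interpret sigma_algebra UNIV "Pow UNIV :: 'a set set" by (rule sigma_algebra_Pow)
  let ?L = "lambda_system UNIV (Pow UNIV) (hausdorff_outer :: 'a set \<Rightarrow> ennreal)"
  have "outer_measure_space (Pow UNIV) (hausdorff_outer :: 'a set \<Rightarrow> ennreal)"
    unfolding outer_measure_space_def positive_def increasing_def countably_subadditive_def
    using hausdorff_outer_mono hausdorff_outer_UN by auto
  then have L: "measure_space UNIV ?L hausdorff_outer"
    by (rule caratheodory_lemma)
  have closed: "F \<in> ?L" if "closed F" for F
    unfolding lambda_system_eq
    by (auto intro!: antisym hausdorff_outer_closed that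
        order_trans[OF hausdorff_outer_mono hausdorff_outer_Un])
  have "sigma_sets UNIV (Collect closed) \<subseteq> ?L"
    using L closed by (intro sigma_algebra.sigma_sets_subset) (auto simp: measure_space_def)
  then have "sets borel \<subseteq> ?L"
    by (simp add: borel_eq_closed)
  then show ?thesis
    using L sets.sigma_algebra_axioms[of "borel :: 'a measure"]
    by (auto simp: measure_space_def positive_def countably_additive_def)
qed

lemma sets_hausdorff_measure [simp, measurable_cong]: "sets hausdorff_measure = sets borel"
  unfolding hausdorff_measure_def
  by (metis sets.sigma_sets_eq sets_measure_of space_borel subset_UNIV Pow_UNIV)

lemma emeasure_hausdorff_measure:
  "A \<in> sets borel \<Longrightarrow> emeasure hausdorff_measure A = hausdorff_outer A"
  unfolding hausdorff_measure_def
  using measure_space_hausdorff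
  by (intro emeasure_measure_of_sigma) (auto simp: measure_space_def)

end

theory Submission
  imports Defs
begin

text \<open>
  The upper inequality is trivial: on a segregated triple the penalty vanishes, so the constant
  sequence recovers the energy (\<open>penalized_energy_segregated\<close>), and elsewhere the constrained energy
  is infinite.

  The content is the lower inequality (\<open>constrained_energy_le_liminf\<close>). Along a sequence with bounded
  energies the Dirichlet integrals are bounded, and the integral of \<open>(u\<^sub>1 u\<^sub>2 u\<^sub>3)\<^sup>2\<close> is at most a
  constant times \<open>\<epsilon>\<close>. A subsequence converges almost everywhere, which carries nonnegativity to the
  limit and, by Fatou's lemma, also the constraint (\<open>AE_product_zero_of_limit\<close>). It remains to see
  that the \<open>L\<^sup>2\<close> limit lies in \<open>H\<^sup>1\<close>, has the prescribed traces, and does not have a larger Dirichlet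
  integral than the lower limit.

  Usually this follows from weak compactness and Mazur's lemma. Here it is proved directly, in
  \<open>strong_approximation_of_L2_limit\<close>: among the functions with the given trace that are \<open>L\<^sup>2\<close>-close to
  the limit, almost minimisers of the Dirichlet integral are Cauchy in \<open>H\<^sup>1\<close> by the parallelogram
  law. The argument uses that the functions with given trace are stable under midpoints
  (\<open>has_trace_midpoint\<close>) and, to conclude, closed under strong \<open>H\<^sup>1\<close> convergence
  (\<open>has_trace_closed\<close>).

  Since \<open>weak_gradient\<close> is an arbitrary choice among all weak gradients, computing with it requires
  uniqueness (\<open>has_weak_gradient_unique\<close>). This is the fundamental lemma of the calculus of
  variations (\<open>fundamental_lemma_calculus_of_variations\<close>), for which explicit bump functions on boxes
  are built from \<open>exp (-1/t)\<close>.
\<close>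

section \<open>Smooth bump functions on boxes\<close>

text \<open>
  For \<open>n = 0\<close> this is the classical function \<open>exp (-1/t)\<close>, smooth and flat at the origin. The extra
  factor \<open>t\<^sup>-\<^sup>n\<close> makes the span of the family closed under differentiation, so that smoothness of all
  of them can be proved by one induction.
\<close>

definition flat :: "nat \<Rightarrow> real \<Rightarrow> real" where
  "flat n t = (if 0 < t then exp (- inverse t) * inverse t ^ n else 0)"

lemma flat_tendsto_0: "(flat n \<longlongrightarrow> 0) (at_right 0)"
proof -
  have "((\<lambda>s. s ^ n / exp s) \<longlongrightarrow> 0) (at_top :: real filter)"
    by (rule tendsto_power_div_exp_0)
  then have "((\<lambda>t. inverse t ^ n / exp (inverse t)) \<longlongrightarrow> (0::real)) (at_right 0)"
    by (rule filterlim_compose) (rule filterlim_inverse_at_top_right)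
  moreover have "\<forall>\<^sub>F t in at_right 0. inverse t ^ n / exp (inverse t) = flat n t"
    by (auto simp: eventually_at_filter flat_def exp_minus field_simps)
  ultimately show ?thesis
    by (rule Lim_transform_eventually)
qed

text \<open>
  At the origin the difference quotient of \<open>flat n\<close> from the right is \<open>flat (n + 1)\<close>, which again
  tends to \<open>0\<close>.
\<close>

lemma flat_has_derivative:
  "(flat n has_real_derivative flat (n + 2) t - real n * flat (n + 1) t) (at t)"
proof -
  consider "t > 0" | "t < 0" | "t = 0" by linarith
  then show ?thesis
  proof cases
    case 1
    have "((\<lambda>t. exp (- inverse t) * inverse t ^ n) has_real_derivative
        flat (n + 2) t - real n * flat (n + 1) t) (at t)"
      using 1
      by (cases n) (auto intro!: derivative_eq_intros simp: flat_def power2_eq_square field_simps,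
          metis One_nat_def gr0I mult.commute power_minus_mult)
    then show ?thesis
      by (rule has_field_derivative_transform_within_open[where S = "{0<..}"])
        (use 1 in \<open>auto simp: flat_def\<close>)
  next
    case 2
    have "((\<lambda>t. 0) has_real_derivative 0) (at t)" by simp
    then have "(flat n has_real_derivative 0) (at t)"
      by (rule has_field_derivative_transform_within_open[where S = "{..<0}"])
        (use 2 in \<open>auto simp: flat_def\<close>)
    then show ?thesis using 2 by (simp add: flat_def)
  next
    case 3
    have "((\<lambda>h. flat n h / h) \<longlongrightarrow> 0) (at_right 0)"
      by (rule Lim_transform_eventually[OF flat_tendsto_0[of "Suc n"]])
        (auto simp: eventually_at_filter flat_def field_simps)
    moreover have "((\<lambda>h. flat n h / h) \<longlongrightarrow> 0) (at_left 0)"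
      by (rule Lim_transform_eventually[OF tendsto_const])
        (auto simp: eventually_at_filter flat_def)
    ultimately have "((\<lambda>h. flat n h / h) \<longlongrightarrow> 0) (at 0)"
      by (simp add: filterlim_split_at)
    then show ?thesis
      using 3 by (simp add: DERIV_def flat_def)
  qed
qed

lemma partial_deriv_eqI:
  "(f has_derivative f') (at x) \<Longrightarrow> partial_deriv j f x = f' (axis j 1)"
  by (simp add: partial_deriv_def frechet_derivative_at[symmetric])

lemma has_derivative_frechetI:
  "f differentiable_on UNIV \<Longrightarrow> (f has_derivative frechet_derivative f (at x)) (at x)"
  by (simp add: differentiable_on_def frechet_derivative_works)

lemma Ck_const: "Ck k (\<lambda>x. c)"
proof (induction k arbitrary: c)
  case (Suc k)
  have "partial_deriv j (\<lambda>x. c) = (\<lambda>x. 0)" for j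
    by (rule ext) (simp add: partial_deriv_def)
  then show ?case using Suc by simp
qed simp

lemma Ck_Suc_imp: "Ck (Suc k) f \<Longrightarrow> Ck k f"
  by (induction k arbitrary: f) (auto intro: differentiable_imp_continuous_on)

lemma Ck_add: "Ck k f \<Longrightarrow> Ck k g \<Longrightarrow> Ck k (\<lambda>x. f x + g x)"
proof (induction k arbitrary: f g)
  case (Suc k)
  have D: "((\<lambda>x. f x + g x) has_derivative
      (\<lambda>h. frechet_derivative f (at x) h + frechet_derivative g (at x) h)) (at x)" for x
    using Suc.prems by (intro has_derivative_add has_derivative_frechetI) auto
  have "partial_deriv j (\<lambda>x. f x + g x) = (\<lambda>x. partial_deriv j f x + partial_deriv j g x)" for j
    using partial_deriv_eqI[OF D] by (auto simp: partial_deriv_def)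
  then show ?case
    using Suc by (auto intro: differentiable_on_add)
qed (auto intro: continuous_intros)

text \<open>
  The product rule expresses the partial derivatives of \<open>f * g\<close> through \<open>f\<close> and \<open>g\<close> themselves and
  their derivatives, so the induction also needs that \<open>Ck\<close> decreases in \<open>k\<close>.
\<close>

lemma Ck_mult: "Ck k f \<Longrightarrow> Ck k g \<Longrightarrow> Ck k (\<lambda>x. f x * g x)"
proof (induction k arbitrary: f g)
  case (Suc k)
  have D: "((\<lambda>x. f x * g x) has_derivative
      (\<lambda>h. f x * frechet_derivative g (at x) h + frechet_derivative f (at x) h * g x)) (at x)" for x
    using Suc.prems by (intro has_derivative_mult has_derivative_frechetI) auto
  have "partial_deriv j (\<lambda>x. f x * g x)
      = (\<lambda>x. f x * partial_deriv j g x + partial_deriv j f x * g x)" for j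
    using partial_deriv_eqI[OF D] by (auto simp: partial_deriv_def)
  then show ?case
    using Suc.prems Suc.IH Ck_Suc_imp[OF Suc.prems(1)] Ck_Suc_imp[OF Suc.prems(2)]
    by (auto intro!: Ck_add differentiable_on_mult)
qed (auto intro: continuous_intros)

lemma Ck_prod: "finite I \<Longrightarrow> (\<And>i. i \<in> I \<Longrightarrow> Ck k (f i)) \<Longrightarrow> Ck k (\<lambda>x. \<Prod>i\<in>I. f i x)"
  by (induction I rule: finite_induct) (auto intro: Ck_const Ck_mult)

lemma Ck_flat: "Ck k (\<lambda>x. flat n (a * x $ i + b))"
proof (induction k arbitrary: n)
  case 0
  have "isCont (flat n) t" for t
    using flat_has_derivative by (rule DERIV_isCont)
  then have "continuous_on UNIV (flat n)"
    by (simp add: continuous_on_eq_continuous_at)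
  then have "continuous_on UNIV (flat n \<circ> (\<lambda>x::plane. a * x $ i + b))"
    by (intro continuous_on_compose continuous_intros) (auto intro: continuous_on_subset)
  then show ?case by (simp add: o_def)
next
  case (Suc k)
  let ?f = "\<lambda>x::plane. flat n (a * x $ i + b)"
  let ?d = "\<lambda>t. flat (n + 2) t - real n * flat (n + 1) t"
  have "((\<lambda>x::plane. a * x $ i + b) has_derivative (\<lambda>h. a * h $ i)) (at x)" for x
    by (auto intro!: derivative_eq_intros bounded_linear_imp_has_derivative bounded_linear_vec_nth)
  from has_derivative_compose[OF this flat_has_derivative[unfolded has_field_derivative_def]]
  have D: "(?f has_derivative (\<lambda>h. ?d (a * x $ i + b) * (a * h $ i))) (at x)" for x .
  have "partial_deriv j ?f = (\<lambda>x. (a * axis j 1 $ i) *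
      (flat (n + 2) (a * x $ i + b) + (- real n) * flat (n + 1) (a * x $ i + b)))" for j
    by (rule ext, subst partial_deriv_eqI[OF D]) (simp add: algebra_simps)
  moreover have "?f differentiable_on UNIV"
    using D by (auto simp: differentiable_on_def differentiable_def)
  moreover have "Ck k (\<lambda>x. (a * axis j 1 $ i) *
      (flat (n + 2) (a * x $ i + b) + (- real n) * flat (n + 1) (a * x $ i + b)))" for j
    by (intro Ck_mult Ck_add Ck_const Suc.IH)
  ultimately show ?case by simp
qed

text \<open>
  Letting the scale \<open>s\<close> tend to infinity, rather than regularising an indicator function by
  convolution, is what makes these bumps exhaust an open box.
\<close>

definition box_bump :: "plane \<Rightarrow> plane \<Rightarrow> real \<Rightarrow> plane \<Rightarrow> real" where
  "box_bump a b s x = (\<Prod>i\<in>UNIV. flat 0 (s * (x $ i - a $ i)) * flat 0 (s * (b $ i - x $ i)))"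

lemma flat_0_bounds: "0 \<le> flat 0 t" "flat 0 t \<le> 1"
  by (auto simp: flat_def)

lemma box_bump_bounds: "0 \<le> box_bump a b s x" "box_bump a b s x \<le> 1"
  by (auto simp: box_bump_def intro!: prod_nonneg prod_le_1 mult_nonneg_nonneg mult_le_one flat_0_bounds)

lemma Ck_box_bump: "Ck k (box_bump a b s)"
proof -
  have "box_bump a b s = (\<lambda>x. \<Prod>i\<in>UNIV. flat 0 (s * x $ i + (- s * a $ i)) * flat 0 ((- s) * x $ i + s * b $ i))"
    by (auto simp: box_bump_def algebra_simps)
  then show ?thesis
    by (simp only:) (intro Ck_prod Ck_mult Ck_flat finite)
qed

lemma box_bump_eq_0:
  assumes "0 < s" "x \<notin> box a b"
  shows "box_bump a b s x = 0"
  using assms by (auto simp: box_bump_def mem_box_cart flat_def zero_less_mult_iff)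

lemma box_bump_tendsto: "(\<lambda>n. box_bump a b (real (Suc n)) x) \<longlonglongrightarrow> indicator (box a b) x"
proof (cases "x \<in> box a b")
  case True
  have lim: "(\<lambda>n. flat 0 (real (Suc n) * t)) \<longlonglongrightarrow> 1" if "0 < t" for t
  proof -
    have "(\<lambda>n. exp (- (inverse (real (Suc n)) * inverse t))) \<longlonglongrightarrow> exp (- (0 * inverse t))"
      by (intro tendsto_intros LIMSEQ_inverse_real_of_nat)
    then show ?thesis
      using that by (simp add: flat_def zero_less_mult_iff)
  qed
  have "(\<lambda>n. box_bump a b (real (Suc n)) x) \<longlonglongrightarrow> (\<Prod>i\<in>(UNIV::2 set). 1 * 1)"
    unfolding box_bump_def using True
    by (intro tendsto_prod tendsto_mult lim) (auto simp: mem_box_cart)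
  then show ?thesis using True by simp
next
  case False
  then show ?thesis by (simp add: box_bump_eq_0)
qed

lemma test_function_box_bump:
  assumes "cbox a b \<subseteq> \<Omega>" "0 < s"
  shows "test_function \<Omega> (box_bump a b s)"
proof -
  have "{x. box_bump a b s x \<noteq> 0} \<subseteq> cbox a b"
    using box_bump_eq_0[OF assms(2)] box_subset_cbox by blast
  then have sub: "closure {x. box_bump a b s x \<noteq> 0} \<subseteq> cbox a b"
    by (rule closure_minimal) (rule closed_cbox)
  then have "compact (closure {x. box_bump a b s x \<noteq> 0})"
    by (meson bounded_cbox bounded_subset closed_closure compact_eq_bounded_closed)
  then show ?thesis
    using sub assms by (auto simp: test_function_def Ck_box_bump)
qed

section \<open>The fundamental lemma of the calculus of variations\<close>

text \<open>
  The positive and the negative part of \<open>f\<close> are densities of two finite measures which agree on open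
  boxes. Open boxes are stable under intersection and generate the Borel sets, so the measures agree,
  and so do their densities almost everywhere. Passing to a Borel representative of \<open>f\<close> first moves
  the argument from Lebesgue measurable sets to Borel sets.
\<close>

lemma AE_lebesgue_zero_if_integral_boxes_zero:
  fixes f :: "'a::euclidean_space \<Rightarrow> real"
  assumes f: "integrable lebesgue f"
    and zero: "\<And>a b. (\<integral>x. f x * indicator (box a b) x \<partial>lebesgue) = 0"
  shows "AE x in lebesgue. f x = 0"
proof -
  obtain g where g[measurable]: "g \<in> borel_measurable lborel" and fg: "AE x in lborel. f x = g x"
    using completion_ex_borel_measurable_real[OF borel_measurable_integrable[OF f]] by blast
  have fg': "AE x in lebesgue. f x = g x"
    using fg by (rule AE_completion)
  have "integrable lebesgue g"
    using g by (intro integrable_cong_AE_imp[OF f _ fg']) (auto intro: measurable_completion)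
  then have gi: "integrable lborel g"
    using g by (simp add: integrable_completion)
  have gz: "(\<integral>x. g x * indicator (box a b) x \<partial>lborel) = 0" for a b
  proof -
    have "(\<integral>x. g x * indicator (box a b) x \<partial>lborel) = (\<integral>x. g x * indicator (box a b) x \<partial>lebesgue)"
      by (simp add: integral_completion)
    also have "\<dots> = (\<integral>x. f x * indicator (box a b) x \<partial>lebesgue)"
      using fg' borel_measurable_integrable[OF f] measurable_completion[OF g]
      by (intro integral_cong_AE borel_measurable_times borel_measurable_indicator)
        (auto simp: lmeasurable_box fmeasurableD)
    finally show ?thesis using zero by simp
  qed
  have fin: "(\<integral>\<^sup>+x. ennreal (g x) \<partial>lborel) \<noteq> \<infinity>" "(\<integral>\<^sup>+x. ennreal (- g x) \<partial>lborel) \<noteq> \<infinity>"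
    using gi by (auto simp: real_integrable_def)
  let ?M = "density lborel (\<lambda>x. ennreal (g x))" and ?N = "density lborel (\<lambda>x. ennreal (- g x))"
  let ?E = "range (\<lambda>(a, b). box a b :: 'a set)"
  let ?A = "\<lambda>n::nat. box (- (real n *\<^sub>R One)) (real n *\<^sub>R One) :: 'a set"
  have box_eq: "emeasure ?M (box a b) = emeasure ?N (box a b)"
    and box_fin: "emeasure ?M (box a b) \<noteq> \<infinity>" for a b
  proof -
    let ?h = "\<lambda>x. g x * indicator (box a b) x"
    have hi: "integrable lborel ?h"
      using gi by (intro integrable_real_mult_indicator) auto
    have M: "emeasure ?M (box a b) = (\<integral>\<^sup>+x. ennreal (?h x) \<partial>lborel)"
      by (subst emeasure_density) (auto intro!: nn_integral_cong split: split_indicator)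
    have N: "emeasure ?N (box a b) = (\<integral>\<^sup>+x. ennreal (- ?h x) \<partial>lborel)"
      by (subst emeasure_density) (auto intro!: nn_integral_cong split: split_indicator)
    have fin': "(\<integral>\<^sup>+x. ennreal (?h x) \<partial>lborel) \<noteq> \<infinity>" "(\<integral>\<^sup>+x. ennreal (- ?h x) \<partial>lborel) \<noteq> \<infinity>"
      using hi by (auto simp: real_integrable_def)
    then show "emeasure ?M (box a b) \<noteq> \<infinity>" by (simp add: M)
    have *: "enn2real (\<integral>\<^sup>+x. ennreal (?h x) \<partial>lborel) = enn2real (\<integral>\<^sup>+x. ennreal (- ?h x) \<partial>lborel)"
      using real_lebesgue_integral_def[OF hi] gz by simp
    then show "emeasure ?M (box a b) = emeasure ?N (box a b)"
      unfolding M N using fin'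
      by (cases rule: ennreal2_cases[of "\<integral>\<^sup>+x. ennreal (?h x) \<partial>lborel" "\<integral>\<^sup>+x. ennreal (- ?h x) \<partial>lborel"]) auto
  qed
  have "?M = ?N"
  proof (rule measure_eqI_generator_eq[where E = ?E and A = ?A and \<Omega> = UNIV])
    show "Int_stable ?E"
      by (auto simp: Int_stable_def box_Int_box)
    show "?E \<subseteq> Pow UNIV" "sets ?M = sigma_sets UNIV ?E" "sets ?N = sigma_sets UNIV ?E"
      by (simp_all add: borel_eq_box)
    show "range ?A \<subseteq> ?E" "(\<Union>i. ?A i) = UNIV"
      unfolding UN_box_eq_UNIV by auto
    show "emeasure ?M (?A i) \<noteq> \<infinity>" for i by (rule box_fin)
    show "emeasure ?M X = emeasure ?N X" if "X \<in> ?E" for X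
      using that box_eq by auto
  qed
  then have "AE x in lborel. ennreal (g x) = ennreal (- g x)"
    using fin by (subst (asm) finite_density_unique) auto
  then have "AE x in lborel. g x = 0"
    by eventually_elim (metis ennreal_eq_0_iff linorder_le_cases neg_0_le_iff_le neg_le_0_iff_le antisym)
  then have "AE x in lebesgue. g x = 0"
    by (rule AE_completion)
  with fg' show ?thesis by eventually_elim simp
qed

text \<open>
  Bump functions that converge to the indicator of a box show that \<open>f\<close> integrates to zero over every
  box whose closure lies in \<open>\<Omega>\<close>. Hence \<open>f\<close> vanishes almost everywhere on each closed box in \<open>\<Omega>\<close>, and
  \<open>\<Omega>\<close> is a countable union of such boxes.
\<close>

lemma fundamental_lemma_calculus_of_variations:
  fixes f :: "plane \<Rightarrow> real"
  assumes "open \<Omega>" and f: "integrable (lebesgue_on \<Omega>) f"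
    and zero: "\<And>\<psi>. test_function \<Omega> \<psi> \<Longrightarrow> (\<integral>x. f x * \<psi> x \<partial>lebesgue_on \<Omega>) = 0"
  shows "AE x in lebesgue_on \<Omega>. f x = 0"
proof -
  have [simp]: "\<Omega> \<in> sets lebesgue" using \<open>open \<Omega>\<close> by auto
  define F where "F x = indicator \<Omega> x * f x" for x
  have Fi: "integrable lebesgue F"
    using f by (simp add: integrable_restrict_space F_def[abs_def])
  have box0: "(\<integral>x. F x * indicator (box a b) x \<partial>lebesgue) = 0" if ab: "cbox a b \<subseteq> \<Omega>" for a b
  proof -
    have "(\<lambda>n. \<integral>x. F x * box_bump a b (real (Suc n)) x \<partial>lebesgue)
        \<longlonglongrightarrow> (\<integral>x. F x * indicator (box a b) x \<partial>lebesgue)"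
    proof (rule integral_dominated_convergence[where w = "\<lambda>x. norm (F x)"])
      have "box_bump a b s \<in> borel_measurable borel" for s
        using Ck_box_bump[of 0 a b s] by (auto intro: borel_measurable_continuous_onI)
      then have "box_bump a b s \<in> borel_measurable lebesgue" for s
        by (auto intro: measurable_completion)
      then show "(\<lambda>x. F x * box_bump a b (real (Suc n)) x) \<in> borel_measurable lebesgue" for n
        using borel_measurable_integrable[OF Fi] by (intro borel_measurable_times)
      show "(\<lambda>x. F x * indicator (box a b) x) \<in> borel_measurable lebesgue"
        using borel_measurable_integrable[OF Fi]
        by (intro borel_measurable_times borel_measurable_indicator)
          (auto simp: lmeasurable_box fmeasurableD)
      show "integrable lebesgue (\<lambda>x. norm (F x))" using Fi by simp
      show "AE x in lebesgue. (\<lambda>n. F x * box_bump a b (real (Suc n)) x) \<longlonglongrightarrow> F x * indicator (box a b) x"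
        by (intro AE_I2 tendsto_intros box_bump_tendsto)
      show "AE x in lebesgue. norm (F x * box_bump a b (real (Suc n)) x) \<le> norm (F x)" for n
        using box_bump_bounds[of a b "real (Suc n)"]
        by (intro AE_I2) (auto simp: abs_mult intro: mult_left_le)
    qed
    moreover have "(\<integral>x. F x * box_bump a b (real (Suc n)) x \<partial>lebesgue) = 0" for n
      using zero[OF test_function_box_bump[OF ab, of "real (Suc n)"]]
      by (simp add: integral_restrict_space F_def mult.assoc)
    ultimately show ?thesis by (simp add: LIMSEQ_const_iff)
  qed
  have cb: "AE x in lebesgue. x \<in> cbox a b \<longrightarrow> F x = 0" if ab: "cbox a b \<subseteq> \<Omega>" for a b
  proof -
    have "AE x in lebesgue. F x * indicator (box a b) x = 0"
    proof (rule AE_lebesgue_zero_if_integral_boxes_zero)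
      show "integrable lebesgue (\<lambda>x. F x * indicator (box a b) x)"
        using Fi by (intro integrable_real_mult_indicator) auto
      fix c d :: plane
      show "(\<integral>x. F x * indicator (box a b) x * indicator (box c d) x \<partial>lebesgue) = 0"
      proof (cases "box a b \<inter> box c d = {}")
        case True
        then have "F x * indicator (box a b) x * indicator (box c d) x = 0" for x
          by (auto split: split_indicator)
        then show ?thesis by (simp only: integral_zero)
      next
        case False
        obtain p q where pq: "box a b \<inter> box c d = box p q"
          by (simp add: box_Int_box)
        have "cbox p q = closure (box p q)"
          using False pq by (simp add: closure_box)
        also have "\<dots> \<subseteq> cbox a b"
          using pq box_subset_cbox by (intro closure_minimal) auto
        finally have "cbox p q \<subseteq> \<Omega>" using ab by blast
        from box0[OF this] show ?thesis
          by (simp add: pq[symmetric] indicator_inter_arith mult.assoc)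
      qed
    qed
    moreover have "AE x in lebesgue. x \<notin> cbox a b - box a b"
      using negligible_frontier_interval[of a b] unfolding negligible_iff_null_sets by (rule AE_not_in)
    ultimately show ?thesis
      by eventually_elim (auto split: split_indicator_asm)
  qed
  obtain \<D> where \<D>: "countable \<D>" "\<D> \<subseteq> Pow \<Omega>" "\<And>X. X \<in> \<D> \<Longrightarrow> \<exists>a b. X = cbox a b" "\<Union>\<D> = \<Omega>"
    using open_countable_Union_open_cbox[OF \<open>open \<Omega>\<close>] by blast
  have "AE x in lebesgue. \<forall>X\<in>\<D>. x \<in> X \<longrightarrow> F x = 0"
    using cb \<D> by (subst AE_ball_countable) (auto, blast)
  then have "AE x in lebesgue. x \<in> \<Omega> \<longrightarrow> f x = 0"
    by eventually_elim (use \<D>(4) in \<open>auto simp: F_def indicator_eq_0_iff\<close>)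
  then show ?thesis
    by (simp add: AE_restrict_space_iff)
qed

section \<open>\<open>L\<^sup>2(\<Omega>)\<close> as a complete inner product space\<close>

lemma L2_iff:
  "f \<in> L2 \<Omega> \<longleftrightarrow> f \<in> borel_measurable (lebesgue_on \<Omega>) \<and>
     integrable (lebesgue_on \<Omega>) (\<lambda>x. (norm (f x))\<^sup>2)"
  by (auto simp: L2_def)

lemma L2_measurable: "f \<in> L2 \<Omega> \<Longrightarrow> f \<in> borel_measurable (lebesgue_on \<Omega>)"
  by (simp add: L2_iff)

lemma L2_integrable_norm_sq: "f \<in> L2 \<Omega> \<Longrightarrow> integrable (lebesgue_on \<Omega>) (\<lambda>x. (norm (f x))\<^sup>2)"
  by (simp add: L2_iff)

lemma L2_norm_nonneg [simp]: "0 \<le> L2_norm \<Omega> f"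
  by (simp add: L2_norm_def)

lemma L2_norm_sq: "(L2_norm \<Omega> f)\<^sup>2 = (\<integral>x. (norm (f x))\<^sup>2 \<partial>lebesgue_on \<Omega>)"
  by (simp add: L2_norm_def)

lemma L2_scaleR: "f \<in> L2 \<Omega> \<Longrightarrow> (\<lambda>x. c *\<^sub>R f x) \<in> L2 \<Omega>"
  by (auto simp: L2_iff power_mult_distrib)

lemma L2_norm_scaleR: "L2_norm \<Omega> (\<lambda>x. c *\<^sub>R f x) = \<bar>c\<bar> * L2_norm \<Omega> f"
  by (simp add: L2_norm_def power_mult_distrib real_sqrt_mult)

lemma L2_add:
  assumes "f \<in> L2 \<Omega>" "g \<in> L2 \<Omega>"
  shows "(\<lambda>x. f x + g x) \<in> L2 \<Omega>"
  unfolding L2_iff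
proof
  show meas: "(\<lambda>x. f x + g x) \<in> borel_measurable (lebesgue_on \<Omega>)"
    using assms by (auto simp: L2_iff)
  have "(norm (f x + g x))\<^sup>2 \<le> 2 * (norm (f x))\<^sup>2 + 2 * (norm (g x))\<^sup>2" for x
  proof -
    have "(norm (f x + g x))\<^sup>2 \<le> (norm (f x) + norm (g x))\<^sup>2"
      by (simp add: norm_triangle_ineq power_mono)
    also have "\<dots> \<le> 2 * (norm (f x))\<^sup>2 + 2 * (norm (g x))\<^sup>2"
      using zero_le_power2[of "norm (f x) - norm (g x)"] by (simp add: power2_diff power2_sum)
    finally show ?thesis .
  qed
  then show "integrable (lebesgue_on \<Omega>) (\<lambda>x. (norm (f x + g x))\<^sup>2)"
    using assms meas
    by (intro Bochner_Integration.integrable_bound[where g = "\<lambda>x. (norm (f x + g x))\<^sup>2"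
          and f = "\<lambda>x. 2 * (norm (f x))\<^sup>2 + 2 * (norm (g x))\<^sup>2"])
      (auto simp: L2_iff)
qed

lemma L2_diff: "f \<in> L2 \<Omega> \<Longrightarrow> g \<in> L2 \<Omega> \<Longrightarrow> (\<lambda>x. f x - g x) \<in> L2 \<Omega>"
  using L2_add[of f \<Omega> "\<lambda>x. (-1) *\<^sub>R g x"] L2_scaleR[of g \<Omega> "-1"] by simp

lemma L2_norm_minus_commute: "L2_norm \<Omega> (\<lambda>x. f x - g x) = L2_norm \<Omega> (\<lambda>x. g x - f x)"
  by (simp add: L2_norm_def norm_minus_commute)

lemma L2_norm_cong_AE:
  assumes "f \<in> L2 \<Omega>" "g \<in> L2 \<Omega>" "AE x in lebesgue_on \<Omega>. f x = g x"
  shows "L2_norm \<Omega> f = L2_norm \<Omega> g"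
  unfolding L2_norm_def
  using assms by (intro arg_cong[where f = sqrt] integral_cong_AE) (auto simp: L2_iff)

lemma integrable_inner_L2:
  assumes "f \<in> L2 \<Omega>" "g \<in> L2 \<Omega>"
  shows "integrable (lebesgue_on \<Omega>) (\<lambda>x. f x \<bullet> g x)"
proof (rule Bochner_Integration.integrable_bound)
  show "integrable (lebesgue_on \<Omega>) (\<lambda>x. (norm (f x))\<^sup>2 + (norm (g x))\<^sup>2)"
    using assms by (simp add: L2_iff)
  show "(\<lambda>x. f x \<bullet> g x) \<in> borel_measurable (lebesgue_on \<Omega>)"
    using assms by (auto simp: L2_iff)
  have "\<bar>f x \<bullet> g x\<bar> \<le> (norm (f x))\<^sup>2 + (norm (g x))\<^sup>2" for x
  proof -
    have "\<bar>f x \<bullet> g x\<bar> \<le> norm (f x) * norm (g x)" by (rule Cauchy_Schwarz_ineq2)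
    also have "\<dots> \<le> (norm (f x))\<^sup>2 + (norm (g x))\<^sup>2"
      using sum_squares_bound[of "norm (f x)" "norm (g x)"]
        mult_nonneg_nonneg[OF norm_ge_zero[of "f x"] norm_ge_zero[of "g x"]] by linarith
    finally show ?thesis .
  qed
  then show "AE x in lebesgue_on \<Omega>. norm (f x \<bullet> g x) \<le> norm ((norm (f x))\<^sup>2 + (norm (g x))\<^sup>2)"
    by simp
qed

text \<open>
  This quadratic polynomial in \<open>c\<close> contains the Hilbert space geometry that is used: its
  nonnegativity is the Cauchy--Schwarz inequality, and its values at \<open>c = 1\<close> and \<open>c = -1\<close> add up to
  the parallelogram law.
\<close>

lemma L2_norm_add_sq:
  assumes "f \<in> L2 \<Omega>" "g \<in> L2 \<Omega>"
  shows "(L2_norm \<Omega> (\<lambda>x. f x + c *\<^sub>R g x))\<^sup>2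
    = (L2_norm \<Omega> f)\<^sup>2 + 2 * c * (\<integral>x. f x \<bullet> g x \<partial>lebesgue_on \<Omega>) + c\<^sup>2 * (L2_norm \<Omega> g)\<^sup>2"
proof -
  have "(norm (f x + c *\<^sub>R g x))\<^sup>2 = (norm (f x))\<^sup>2 + 2 * c * (f x \<bullet> g x) + c\<^sup>2 * (norm (g x))\<^sup>2" for x
    by (simp only: power2_norm_eq_inner) (simp add: inner_add inner_commute algebra_simps power2_eq_square)
  then show ?thesis
    unfolding L2_norm_sq
    using assms by (simp add: integrable_inner_L2 L2_integrable_norm_sq)
qed

text \<open>
  The second term involves the midpoint of \<open>f\<close> and \<open>g\<close>: this is the form in which the identity turns
  two almost minimisers over a convex set into two functions that are close to each other.
\<close>

lemma L2_parallelogram: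
  assumes "f \<in> L2 \<Omega>" "g \<in> L2 \<Omega>"
  shows "(L2_norm \<Omega> (\<lambda>x. f x - g x))\<^sup>2 + 4 * (L2_norm \<Omega> (\<lambda>x. (1/2) *\<^sub>R f x + (1/2) *\<^sub>R g x))\<^sup>2
    = 2 * (L2_norm \<Omega> f)\<^sup>2 + 2 * (L2_norm \<Omega> g)\<^sup>2"
proof -
  have *: "L2_norm \<Omega> (\<lambda>x. (1/2) *\<^sub>R f x + (1/2) *\<^sub>R g x) = L2_norm \<Omega> (\<lambda>x. f x + g x) / 2"
    using L2_norm_scaleR[of \<Omega> "1/2" "\<lambda>x. f x + g x"] by (simp add: scaleR_add_right)
  then show ?thesis
    unfolding * using L2_norm_add_sq[OF assms, of "-1"] L2_norm_add_sq[OF assms, of 1]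
    by (simp add: power_divide field_simps)
qed

lemma L2_Cauchy_Schwarz:
  assumes "f \<in> L2 \<Omega>" "g \<in> L2 \<Omega>"
  shows "\<bar>\<integral>x. f x \<bullet> g x \<partial>lebesgue_on \<Omega>\<bar> \<le> L2_norm \<Omega> f * L2_norm \<Omega> g"
proof -
  define F where "F = (L2_norm \<Omega> f)\<^sup>2"
  define G where "G = (L2_norm \<Omega> g)\<^sup>2"
  define I where "I = (\<integral>x. f x \<bullet> g x \<partial>lebesgue_on \<Omega>)"
  have pos: "0 \<le> F + 2 * c * I + c\<^sup>2 * G" for c
    using L2_norm_add_sq[OF assms, of c] by (metis F_def G_def I_def zero_le_power2)
  have "I\<^sup>2 \<le> F * G"
  proof (cases "G = 0")
    case True
    have "I = 0"
    proof (rule ccontr)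
      assume "I \<noteq> 0"
      (* for G = 0 the polynomial is affine in c, with the value -1 at the c chosen here *)
      then show False
        using pos[of "- (F + 1) / (2 * I)"] True by (simp add: field_simps)
    qed
    then show ?thesis using True by simp
  next
    case False
    then have "0 < G" by (simp add: G_def)
    then show ?thesis
      using pos[of "- I / G"] by (simp add: field_simps power2_eq_square)
  qed
  then have "\<bar>I\<bar> \<le> sqrt (F * G)"
    using real_sqrt_le_mono by fastforce
  also have "\<dots> = L2_norm \<Omega> f * L2_norm \<Omega> g"
    by (simp add: F_def G_def real_sqrt_mult)
  finally show ?thesis by (simp add: I_def)
qed

lemma L2_norm_triangle:
  assumes "f \<in> L2 \<Omega>" "g \<in> L2 \<Omega>"
  shows "L2_norm \<Omega> (\<lambda>x. f x + g x) \<le> L2_norm \<Omega> f + L2_norm \<Omega> g"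
proof (rule power2_le_imp_le)
  show "(L2_norm \<Omega> (\<lambda>x. f x + g x))\<^sup>2 \<le> (L2_norm \<Omega> f + L2_norm \<Omega> g)\<^sup>2"
    using L2_norm_add_sq[OF assms, of 1] L2_Cauchy_Schwarz[OF assms] by (simp add: power2_sum)
qed simp

lemma tendsto_integral_inner_L2:
  assumes "\<And>n. f n \<in> L2 \<Omega>" "g \<in> L2 \<Omega>" "h \<in> L2 \<Omega>"
    and lim: "(\<lambda>n. L2_norm \<Omega> (\<lambda>x. f n x - g x)) \<longlonglongrightarrow> 0"
  shows "(\<lambda>n. \<integral>x. f n x \<bullet> h x \<partial>lebesgue_on \<Omega>) \<longlonglongrightarrow> (\<integral>x. g x \<bullet> h x \<partial>lebesgue_on \<Omega>)"
proof -
  have "(\<lambda>n. (\<integral>x. f n x \<bullet> h x \<partial>lebesgue_on \<Omega>) - (\<integral>x. g x \<bullet> h x \<partial>lebesgue_on \<Omega>)) \<longlonglongrightarrow> 0"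
  proof (rule Lim_null_comparison)
    show "\<forall>\<^sub>F n in sequentially. norm ((\<integral>x. f n x \<bullet> h x \<partial>lebesgue_on \<Omega>) - (\<integral>x. g x \<bullet> h x \<partial>lebesgue_on \<Omega>))
        \<le> L2_norm \<Omega> (\<lambda>x. f n x - g x) * L2_norm \<Omega> h"
      using L2_Cauchy_Schwarz[OF L2_diff[OF assms(1,2)] assms(3)]
      by (simp add: inner_diff_left integrable_inner_L2 assms)
    show "(\<lambda>n. L2_norm \<Omega> (\<lambda>x. f n x - g x) * L2_norm \<Omega> h) \<longlonglongrightarrow> 0"
      using tendsto_mult_left_zero[OF lim] .
  qed
  then show ?thesis by (simp add: LIM_zero_iff)
qed

lemma nn_integral_L2:
  "f \<in> L2 \<Omega> \<Longrightarrow> (\<integral>\<^sup>+x. ennreal ((norm (f x))\<^sup>2) \<partial>lebesgue_on \<Omega>) = ennreal ((L2_norm \<Omega> f)\<^sup>2)"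
  by (simp add: L2_norm_sq nn_integral_eq_integral L2_iff)

text \<open>
  This converts the conclusion of Fatou's lemma back into a bound for the \<open>L\<^sup>2\<close> norm.
\<close>

lemma L2_if_nn_integral_le:
  assumes "f \<in> borel_measurable (lebesgue_on \<Omega>)" "0 \<le> c"
    and "(\<integral>\<^sup>+x. ennreal ((norm (f x))\<^sup>2) \<partial>lebesgue_on \<Omega>) \<le> ennreal (c\<^sup>2)"
  shows "f \<in> L2 \<Omega>" "L2_norm \<Omega> f \<le> c"
proof -
  have "(\<integral>\<^sup>+x. ennreal ((norm (f x))\<^sup>2) \<partial>lebesgue_on \<Omega>) < \<infinity>"
    using assms(3) by (metis ennreal_less_top infinity_ennreal_def order_le_less_trans)
  then show "f \<in> L2 \<Omega>"
    using assms(1) by (auto simp: L2_iff integrable_iff_bounded)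
  then have "ennreal ((L2_norm \<Omega> f)\<^sup>2) \<le> ennreal (c\<^sup>2)"
    using assms(3) by (simp add: nn_integral_L2)
  then have "(L2_norm \<Omega> f)\<^sup>2 \<le> c\<^sup>2"
    by (simp only: ennreal_le_iff zero_le_power2)
  then show "L2_norm \<Omega> f \<le> c"
    using assms(2) by (rule power2_le_imp_le)
qed

lemma continuous_imp_L2:
  fixes f :: "plane \<Rightarrow> 'b::euclidean_space"
  assumes "open \<Omega>" "bounded \<Omega>" "continuous_on (closure \<Omega>) f"
  shows "f \<in> L2 \<Omega>"
proof -
  interpret finite_measure "lebesgue_on \<Omega>"
    using assms by (intro finite_measure_lebesgue_on lmeasurable_open)
  have meas: "f \<in> borel_measurable (lebesgue_on \<Omega>)"
    using assms closure_subset
    by (intro continuous_imp_measurable_on_sets_lebesgue) (auto intro: continuous_on_subset)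
  have "compact (f ` closure \<Omega>)"
    using assms by (intro compact_continuous_image) (auto simp: compact_closure)
  then obtain B where B: "\<And>x. x \<in> closure \<Omega> \<Longrightarrow> norm (f x) \<le> B"
    using compact_imp_bounded bounded_iff by (metis imageI)
  have "integrable (lebesgue_on \<Omega>) (\<lambda>x. (norm (f x))\<^sup>2)"
  proof (rule integrable_const_bound[where B = "B\<^sup>2"])
    show "AE x in lebesgue_on \<Omega>. norm ((norm (f x))\<^sup>2) \<le> B\<^sup>2"
      using B closure_subset[of \<Omega>] by (intro AE_I2) (auto intro!: power_mono)
  qed (use meas in simp)
  then show ?thesis
    using meas by (simp add: L2_iff)
qed

lemma L2_imp_L1:
  fixes f :: "plane \<Rightarrow> 'b::euclidean_space"
  assumes "open \<Omega>" "bounded \<Omega>" "f \<in> L2 \<Omega>"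
  shows "integrable (lebesgue_on \<Omega>) f"
    and "(\<integral>x. norm (f x) \<partial>lebesgue_on \<Omega>) \<le> L2_norm \<Omega> f * L2_norm \<Omega> (\<lambda>x. 1 :: real)"
proof -
  have one: "(\<lambda>x. 1 :: real) \<in> L2 \<Omega>"
    using assms by (intro continuous_imp_L2) auto
  have nf: "(\<lambda>x. norm (f x)) \<in> L2 \<Omega>" "L2_norm \<Omega> (\<lambda>x. norm (f x)) = L2_norm \<Omega> f"
    using assms(3) by (auto simp: L2_iff L2_norm_def)
  have "integrable (lebesgue_on \<Omega>) (\<lambda>x. norm (f x))"
    using integrable_inner_L2[OF nf(1) one] by simp
  then show "integrable (lebesgue_on \<Omega>) f"
    using L2_measurable[OF assms(3)] by (simp add: integrable_norm_iff)
  show "(\<integral>x. norm (f x) \<partial>lebesgue_on \<Omega>) \<le> L2_norm \<Omega> f * L2_norm \<Omega> (\<lambda>x. 1 :: real)"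
    using L2_Cauchy_Schwarz[OF nf(1) one] by (simp add: nf(2))
qed

text \<open>
  On a bounded set an \<open>L\<^sup>2\<close> Cauchy sequence is Cauchy in \<open>L\<^sup>1\<close>, hence a subsequence converges almost
  everywhere. Fatou's lemma, applied to \<open>f n - f (r k)\<close> with \<open>n\<close> fixed and \<open>k\<close> tending to infinity,
  shows that the pointwise limit is the limit in \<open>L\<^sup>2\<close>.
\<close>

lemma L2_complete:
  fixes f :: "nat \<Rightarrow> plane \<Rightarrow> 'b::euclidean_space"
  assumes \<Omega>: "open \<Omega>" "bounded \<Omega>" and f: "\<And>n. f n \<in> L2 \<Omega>"
    and Cauchy: "\<And>e. 0 < e \<Longrightarrow> \<exists>N. \<forall>m\<ge>N. \<forall>n\<ge>N. L2_norm \<Omega> (\<lambda>x. f m x - f n x) < e"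
  obtains g where "g \<in> L2 \<Omega>" "(\<lambda>n. L2_norm \<Omega> (\<lambda>x. f n x - g x)) \<longlonglongrightarrow> 0"
proof -
  have meas[measurable]: "f n \<in> borel_measurable (lebesgue_on \<Omega>)" for n
    using f by (rule L2_measurable)
  (* adding 1 keeps c positive when the norm of the constant function vanishes *)
  define c where "c = L2_norm \<Omega> (\<lambda>x. 1 :: real) + 1"
  have c: "0 < c" unfolding c_def by (simp add: add_nonneg_pos)
  obtain r where r: "strict_mono r" and ae: "AE x in lebesgue_on \<Omega>. Cauchy (\<lambda>i. f (r i) x)"
  proof (rule cauchy_L1_AE_cauchy_subseq[of "lebesgue_on \<Omega>" f])
    show "integrable (lebesgue_on \<Omega>) (f n)" for n
      using \<Omega> f by (rule L2_imp_L1)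
    fix e :: real assume "0 < e"
    then obtain N where N: "\<And>m n. m \<ge> N \<Longrightarrow> n \<ge> N \<Longrightarrow> L2_norm \<Omega> (\<lambda>x. f m x - f n x) < e / c"
      using Cauchy[of "e / c"] c by auto
    have "(\<integral>x. norm (f m x - f n x) \<partial>lebesgue_on \<Omega>) < e" if "m \<ge> N" "n \<ge> N" for m n
    proof -
      have "(\<integral>x. norm (f m x - f n x) \<partial>lebesgue_on \<Omega>)
          \<le> L2_norm \<Omega> (\<lambda>x. f m x - f n x) * L2_norm \<Omega> (\<lambda>x. 1 :: real)"
        using \<Omega> L2_diff[OF f f] by (rule L2_imp_L1)
      also have "\<dots> \<le> L2_norm \<Omega> (\<lambda>x. f m x - f n x) * c"
        by (intro mult_left_mono) (auto simp: c_def)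
      also have "\<dots> < e"
        using N[OF that] c by (simp add: pos_less_divide_eq)
      finally show ?thesis .
    qed
    then show "\<exists>N. \<forall>i\<ge>N. \<forall>j\<ge>N. (\<integral>x. norm (f i x - f j x) \<partial>lebesgue_on \<Omega>) < e" by blast
  qed blast
  define g where "g x = lim (\<lambda>i. f (r i) x)" for x
  have g[measurable]: "g \<in> borel_measurable (lebesgue_on \<Omega>)"
    unfolding g_def by (rule borel_measurable_lim_metric) simp
  have lim: "AE x in lebesgue_on \<Omega>. (\<lambda>i. f (r i) x) \<longlonglongrightarrow> g x"
    using ae by eventually_elim (simp add: g_def Cauchy_convergent_iff convergent_LIMSEQ_iff)
  have close: "\<exists>N. \<forall>n\<ge>N. (\<lambda>x. f n x - g x) \<in> L2 \<Omega> \<and> L2_norm \<Omega> (\<lambda>x. f n x - g x) \<le> e"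
    if e: "0 < e" for e
  proof -
    obtain N where N: "\<And>m n. m \<ge> N \<Longrightarrow> n \<ge> N \<Longrightarrow> L2_norm \<Omega> (\<lambda>x. f m x - f n x) < e"
      using Cauchy[OF e] by auto
    have bd: "(\<integral>\<^sup>+x. ennreal ((norm (f n x - g x))\<^sup>2) \<partial>lebesgue_on \<Omega>) \<le> ennreal (e\<^sup>2)" if n: "n \<ge> N" for n
    proof -
      have "(\<integral>\<^sup>+x. ennreal ((norm (f n x - g x))\<^sup>2) \<partial>lebesgue_on \<Omega>)
          = (\<integral>\<^sup>+x. liminf (\<lambda>k. ennreal ((norm (f n x - f (r k) x))\<^sup>2)) \<partial>lebesgue_on \<Omega>)"
      proof (rule nn_integral_cong_AE)
        show "AE x in lebesgue_on \<Omega>. ennreal ((norm (f n x - g x))\<^sup>2)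
            = liminf (\<lambda>k. ennreal ((norm (f n x - f (r k) x))\<^sup>2))"
          using lim
        proof eventually_elim
          case (elim x)
          then have "(\<lambda>k. ennreal ((norm (f n x - f (r k) x))\<^sup>2)) \<longlonglongrightarrow> ennreal ((norm (f n x - g x))\<^sup>2)"
            by (intro tendsto_intros)
          from lim_imp_Liminf[OF sequentially_bot this] show ?case by simp
        qed
      qed
      also have "\<dots> \<le> liminf (\<lambda>k. \<integral>\<^sup>+x. ennreal ((norm (f n x - f (r k) x))\<^sup>2) \<partial>lebesgue_on \<Omega>)"
        by (rule nn_integral_liminf) measurable
      also have "\<dots> \<le> ennreal (e\<^sup>2)"
      proof (rule Liminf_le)
        show "\<forall>\<^sub>F k in sequentially. (\<integral>\<^sup>+x. ennreal ((norm (f n x - f (r k) x))\<^sup>2) \<partial>lebesgue_on \<Omega>) \<le> ennreal (e\<^sup>2)"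
          unfolding eventually_sequentially
        proof (intro exI allI impI)
          fix k assume "N \<le> k"
          then have "N \<le> r k" using seq_suble[OF r, of k] by linarith
          then show "(\<integral>\<^sup>+x. ennreal ((norm (f n x - f (r k) x))\<^sup>2) \<partial>lebesgue_on \<Omega>) \<le> ennreal (e\<^sup>2)"
            using N[OF n, of "r k"] e by (simp add: nn_integral_L2[OF L2_diff[OF f f]] power_mono)
        qed
      qed simp
      finally show ?thesis .
    qed
    have "(\<lambda>x. f n x - g x) \<in> L2 \<Omega>" "L2_norm \<Omega> (\<lambda>x. f n x - g x) \<le> e" if "n \<ge> N" for n
      using bd[OF that] e by (auto intro!: L2_if_nn_integral_le[where c = e])
    then show ?thesis by blast
  qed
  show thesis
  proof
    obtain n where "(\<lambda>x. f n x - g x) \<in> L2 \<Omega>"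
      using close[of 1] by auto
    then show "g \<in> L2 \<Omega>"
      using L2_diff[OF f[of n]] by fastforce
    show "(\<lambda>n. L2_norm \<Omega> (\<lambda>x. f n x - g x)) \<longlonglongrightarrow> 0"
    proof (rule LIMSEQ_I)
      fix e :: real assume "0 < e"
      then obtain N where "\<forall>n\<ge>N. L2_norm \<Omega> (\<lambda>x. f n x - g x) \<le> e / 2"
        using close[of "e / 2"] by auto
      then show "\<exists>N. \<forall>n\<ge>N. norm (L2_norm \<Omega> (\<lambda>x. f n x - g x) - 0) < e"
        using \<open>0 < e\<close> by (intro exI[of _ N]) (auto intro: le_less_trans)
    qed
  qed
qed

section \<open>Weak gradients and the \<open>H\<^sup>1\<close> norm\<close>

lemma continuous_test_function:
  assumes "test_function \<Omega> \<psi>"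
  shows "continuous_on UNIV \<psi>" "continuous_on UNIV (partial_deriv j \<psi>)"
proof -
  have "Ck 0 \<psi>" "Ck (Suc 0) \<psi>"
    using assms unfolding test_function_def by blast+
  then show "continuous_on UNIV \<psi>" "continuous_on UNIV (partial_deriv j \<psi>)" by auto
qed

lemma test_function_L2:
  assumes "open \<Omega>" "bounded \<Omega>" "test_function \<Omega> \<psi>"
  shows "partial_deriv j \<psi> \<in> L2 \<Omega>" "(\<lambda>x. axis j (\<psi> x) :: plane) \<in> L2 \<Omega>"
proof -
  have "continuous_on (closure \<Omega>) (partial_deriv j \<psi>)" "continuous_on (closure \<Omega>) \<psi>"
    using continuous_test_function[OF assms(3)] continuous_on_subset by blast+
  moreover have "(\<lambda>x. axis j (\<psi> x) :: plane) = (\<lambda>x. \<psi> x *\<^sub>R axis j 1)"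
    by (simp add: fun_eq_iff vec_eq_iff axis_def)
  ultimately show "partial_deriv j \<psi> \<in> L2 \<Omega>" "(\<lambda>x. axis j (\<psi> x) :: plane) \<in> L2 \<Omega>"
    using assms by (auto intro!: continuous_imp_L2 continuous_intros)
qed

text \<open>
  Both sides of the integration by parts formula become \<open>L\<^sup>2\<close> inner products with a fixed function;
  linearity and continuity of the inner product then transfer to weak gradients.
\<close>

lemma has_weak_gradient_inner:
  "has_weak_gradient \<Omega> u g \<longleftrightarrow> g \<in> L2 \<Omega> \<and>
     (\<forall>\<psi> j. test_function \<Omega> \<psi> \<longrightarrow>
        (\<integral>x. u x \<bullet> partial_deriv j \<psi> x \<partial>lebesgue_on \<Omega>) = - (\<integral>x. g x \<bullet> axis j (\<psi> x) \<partial>lebesgue_on \<Omega>))"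
  by (simp add: has_weak_gradient_def inner_axis)

lemma has_weak_gradient_lincomb:
  assumes "open \<Omega>" "bounded \<Omega>" "u \<in> L2 \<Omega>" "v \<in> L2 \<Omega>"
    and g: "has_weak_gradient \<Omega> u g" and h: "has_weak_gradient \<Omega> v h"
  shows "has_weak_gradient \<Omega> (\<lambda>x. a *\<^sub>R u x + b *\<^sub>R v x) (\<lambda>x. a *\<^sub>R g x + b *\<^sub>R h x)"
  unfolding has_weak_gradient_inner
proof (intro conjI allI impI)
  have gh: "g \<in> L2 \<Omega>" "h \<in> L2 \<Omega>"
    using g h by (auto simp: has_weak_gradient_def)
  then show "(\<lambda>x. a *\<^sub>R g x + b *\<^sub>R h x) \<in> L2 \<Omega>"
    by (intro L2_add L2_scaleR)
  fix \<psi> j assume \<psi>: "test_function \<Omega> \<psi>"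
  note * = test_function_L2[OF assms(1,2) \<psi>, of j]
  show "(\<integral>x. (a *\<^sub>R u x + b *\<^sub>R v x) \<bullet> partial_deriv j \<psi> x \<partial>lebesgue_on \<Omega>)
      = - (\<integral>x. (a *\<^sub>R g x + b *\<^sub>R h x) \<bullet> axis j (\<psi> x) \<partial>lebesgue_on \<Omega>)"
    using g h \<psi> integrable_inner_L2[OF assms(3) *(1)] integrable_inner_L2[OF assms(4) *(1)]
      integrable_inner_L2[OF gh(1) *(2)] integrable_inner_L2[OF gh(2) *(2)]
    by (simp only: has_weak_gradient_inner inner_add_left inner_scaleR_left
        Bochner_Integration.integral_add integral_mult_right_zero integrable_mult_right)
qed

lemma has_weak_gradient_limit:
  assumes "open \<Omega>" "bounded \<Omega>" "\<And>n. u n \<in> L2 \<Omega>" "v \<in> L2 \<Omega>" "h \<in> L2 \<Omega>"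
    and g: "\<And>n. has_weak_gradient \<Omega> (u n) (g n)"
    and "(\<lambda>n. L2_norm \<Omega> (\<lambda>x. u n x - v x)) \<longlonglongrightarrow> 0"
    and "(\<lambda>n. L2_norm \<Omega> (\<lambda>x. g n x - h x)) \<longlonglongrightarrow> 0"
  shows "has_weak_gradient \<Omega> v h"
  unfolding has_weak_gradient_inner
proof (intro conjI allI impI)
  have gL: "g n \<in> L2 \<Omega>" for n
    using g by (simp add: has_weak_gradient_def)
  fix \<psi> j assume \<psi>: "test_function \<Omega> \<psi>"
  note * = test_function_L2[OF assms(1,2) \<psi>, of j]
  have "(\<lambda>n. \<integral>x. u n x \<bullet> partial_deriv j \<psi> x \<partial>lebesgue_on \<Omega>) \<longlonglongrightarrow> (\<integral>x. v x \<bullet> partial_deriv j \<psi> x \<partial>lebesgue_on \<Omega>)"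
    by (rule tendsto_integral_inner_L2) (fact assms *)+
  moreover have "(\<lambda>n. - (\<integral>x. g n x \<bullet> axis j (\<psi> x) \<partial>lebesgue_on \<Omega>)) \<longlonglongrightarrow> - (\<integral>x. h x \<bullet> axis j (\<psi> x) \<partial>lebesgue_on \<Omega>)"
    by (rule tendsto_minus, rule tendsto_integral_inner_L2) (fact assms * gL)+
  ultimately show "(\<integral>x. v x \<bullet> partial_deriv j \<psi> x \<partial>lebesgue_on \<Omega>) = - (\<integral>x. h x \<bullet> axis j (\<psi> x) \<partial>lebesgue_on \<Omega>)"
    using g \<psi> LIMSEQ_unique by (simp add: has_weak_gradient_inner)
qed (fact assms)

text \<open>
  Uniqueness is what gives meaning to \<open>weak_gradient\<close>, which is an arbitrary choice: it ensures that
  the chosen gradient of a sum, or of a limit, has the norm of the sum, or the limit, of the chosen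
  gradients.
\<close>

lemma has_weak_gradient_unique:
  assumes "open \<Omega>" "bounded \<Omega>" "has_weak_gradient \<Omega> u g" "has_weak_gradient \<Omega> u h"
  shows "AE x in lebesgue_on \<Omega>. g x = h x"
proof -
  have L: "(\<lambda>x. g x - h x) \<in> L2 \<Omega>" "g \<in> L2 \<Omega>" "h \<in> L2 \<Omega>"
    using assms by (auto simp: has_weak_gradient_def intro: L2_diff)
  have "AE x in lebesgue_on \<Omega>. (g x - h x) $ j = 0" for j
  proof (rule fundamental_lemma_calculus_of_variations[OF assms(1)])
    show "integrable (lebesgue_on \<Omega>) (\<lambda>x. (g x - h x) $ j)"
      using L2_imp_L1(1)[OF assms(1,2) L(1)] by (rule integrable_bounded_linear[OF bounded_linear_vec_nth])
    fix \<psi> assume \<psi>: "test_function \<Omega> \<psi>"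
    note * = test_function_L2[OF assms(1,2) \<psi>, of j]
    have "(\<integral>x. (g x - h x) $ j * \<psi> x \<partial>lebesgue_on \<Omega>)
        = (\<integral>x. g x \<bullet> axis j (\<psi> x) - h x \<bullet> axis j (\<psi> x) \<partial>lebesgue_on \<Omega>)"
      by (simp add: inner_axis algebra_simps)
    also have "\<dots> = (\<integral>x. g x \<bullet> axis j (\<psi> x) \<partial>lebesgue_on \<Omega>) - (\<integral>x. h x \<bullet> axis j (\<psi> x) \<partial>lebesgue_on \<Omega>)"
      using integrable_inner_L2[OF L(2) *(2)] integrable_inner_L2[OF L(3) *(2)]
      by (rule Bochner_Integration.integral_diff)
    also have "\<dots> = 0"
    proof -
      have "(\<integral>x. u x \<bullet> partial_deriv j \<psi> x \<partial>lebesgue_on \<Omega>) = - (\<integral>x. g x \<bullet> axis j (\<psi> x) \<partial>lebesgue_on \<Omega>)"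
        using assms(3) \<psi> unfolding has_weak_gradient_inner by blast
      moreover have "(\<integral>x. u x \<bullet> partial_deriv j \<psi> x \<partial>lebesgue_on \<Omega>) = - (\<integral>x. h x \<bullet> axis j (\<psi> x) \<partial>lebesgue_on \<Omega>)"
        using assms(4) \<psi> unfolding has_weak_gradient_inner by blast
      ultimately show ?thesis by linarith
    qed
    finally show "(\<integral>x. (g x - h x) $ j * \<psi> x \<partial>lebesgue_on \<Omega>) = 0" .
  qed
  then have "AE x in lebesgue_on \<Omega>. \<forall>j. (g x - h x) $ j = 0"
    by (simp add: AE_all_countable)
  then show ?thesis
    by eventually_elim (simp add: vec_eq_iff)
qed

lemma H1_L2: "u \<in> H1 \<Omega> \<Longrightarrow> u \<in> L2 \<Omega>"
  by (simp add: H1_def)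

lemma H1_has_weak_gradient: "u \<in> H1 \<Omega> \<Longrightarrow> has_weak_gradient \<Omega> u (weak_gradient \<Omega> u)"
  unfolding H1_def weak_gradient_def by (auto intro: someI[of "has_weak_gradient \<Omega> u"])

lemma weak_gradient_L2: "u \<in> H1 \<Omega> \<Longrightarrow> weak_gradient \<Omega> u \<in> L2 \<Omega>"
  using H1_has_weak_gradient by (auto simp: has_weak_gradient_def)

lemma L2_norm_weak_gradient:
  assumes "open \<Omega>" "bounded \<Omega>" "u \<in> L2 \<Omega>" "has_weak_gradient \<Omega> u g"
  shows "L2_norm \<Omega> (weak_gradient \<Omega> u) = L2_norm \<Omega> g"
proof -
  have "u \<in> H1 \<Omega>" using assms by (auto simp: H1_def)
  then show ?thesis
    using has_weak_gradient_unique[OF assms(1,2) H1_has_weak_gradient assms(4)] assms(4)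
    by (intro L2_norm_cong_AE) (auto simp: weak_gradient_L2 has_weak_gradient_def)
qed

lemma H1_lincomb:
  assumes "open \<Omega>" "bounded \<Omega>" "u \<in> H1 \<Omega>" "v \<in> H1 \<Omega>"
  shows "(\<lambda>x. a *\<^sub>R u x + b *\<^sub>R v x) \<in> H1 \<Omega>"
    and "L2_norm \<Omega> (weak_gradient \<Omega> (\<lambda>x. a *\<^sub>R u x + b *\<^sub>R v x))
      = L2_norm \<Omega> (\<lambda>x. a *\<^sub>R weak_gradient \<Omega> u x + b *\<^sub>R weak_gradient \<Omega> v x)"
proof -
  have L: "(\<lambda>x. a *\<^sub>R u x + b *\<^sub>R v x) \<in> L2 \<Omega>"
    using assms by (intro L2_add L2_scaleR H1_L2)
  have G: "has_weak_gradient \<Omega> (\<lambda>x. a *\<^sub>R u x + b *\<^sub>R v x)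
      (\<lambda>x. a *\<^sub>R weak_gradient \<Omega> u x + b *\<^sub>R weak_gradient \<Omega> v x)"
    using assms by (intro has_weak_gradient_lincomb H1_L2 H1_has_weak_gradient)
  show "(\<lambda>x. a *\<^sub>R u x + b *\<^sub>R v x) \<in> H1 \<Omega>"
    using L G by (auto simp: H1_def)
  show "L2_norm \<Omega> (weak_gradient \<Omega> (\<lambda>x. a *\<^sub>R u x + b *\<^sub>R v x))
      = L2_norm \<Omega> (\<lambda>x. a *\<^sub>R weak_gradient \<Omega> u x + b *\<^sub>R weak_gradient \<Omega> v x)"
    by (rule L2_norm_weak_gradient[OF assms(1,2) L G])
qed

lemma H1_diff:
  assumes "open \<Omega>" "bounded \<Omega>" "u \<in> H1 \<Omega>" "v \<in> H1 \<Omega>"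
  shows "(\<lambda>x. u x - v x) \<in> H1 \<Omega>"
    and "L2_norm \<Omega> (weak_gradient \<Omega> (\<lambda>x. u x - v x))
      = L2_norm \<Omega> (\<lambda>x. weak_gradient \<Omega> u x - weak_gradient \<Omega> v x)"
  using H1_lincomb[OF assms, of 1 "-1"] by simp_all

lemma H1_midpoint:
  assumes "open \<Omega>" "bounded \<Omega>" "u \<in> H1 \<Omega>" "v \<in> H1 \<Omega>"
  shows "(\<lambda>x. (u x + v x) / 2) \<in> H1 \<Omega>"
    and "L2_norm \<Omega> (weak_gradient \<Omega> (\<lambda>x. (u x + v x) / 2))
      = L2_norm \<Omega> (\<lambda>x. (1/2) *\<^sub>R weak_gradient \<Omega> u x + (1/2) *\<^sub>R weak_gradient \<Omega> v x)"
  using H1_lincomb[OF assms, of "1/2" "1/2"] by (simp_all add: add_divide_distrib)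

lemma H1_norm_lincomb:
  assumes "open \<Omega>" "bounded \<Omega>" "u \<in> H1 \<Omega>" "v \<in> H1 \<Omega>"
  shows "H1_norm \<Omega> (\<lambda>x. a *\<^sub>R u x + b *\<^sub>R v x) \<le> \<bar>a\<bar> * H1_norm \<Omega> u + \<bar>b\<bar> * H1_norm \<Omega> v"
proof -
  let ?n = "L2_norm \<Omega>" and ?G = "\<lambda>u. L2_norm \<Omega> (weak_gradient \<Omega> u)"
  have hom: "\<bar>c\<bar> * sqrt (p\<^sup>2 + q\<^sup>2) = sqrt ((\<bar>c\<bar> * p)\<^sup>2 + (\<bar>c\<bar> * q)\<^sup>2)" for c p q :: real
  proof -
    have "(\<bar>c\<bar> * p)\<^sup>2 + (\<bar>c\<bar> * q)\<^sup>2 = c\<^sup>2 * (p\<^sup>2 + q\<^sup>2)"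
      by (simp add: power_mult_distrib algebra_simps)
    then show ?thesis by (simp only: real_sqrt_mult real_sqrt_abs)
  qed
  have "?n (\<lambda>x. a *\<^sub>R u x + b *\<^sub>R v x) \<le> \<bar>a\<bar> * ?n u + \<bar>b\<bar> * ?n v"
    using L2_norm_triangle[OF L2_scaleR[OF H1_L2[OF assms(3)], of a] L2_scaleR[OF H1_L2[OF assms(4)], of b]]
    unfolding L2_norm_scaleR .
  moreover have "?G (\<lambda>x. a *\<^sub>R u x + b *\<^sub>R v x) \<le> \<bar>a\<bar> * ?G u + \<bar>b\<bar> * ?G v"
    using L2_norm_triangle[OF L2_scaleR[OF weak_gradient_L2[OF assms(3)], of a]
        L2_scaleR[OF weak_gradient_L2[OF assms(4)], of b]]
    unfolding L2_norm_scaleR H1_lincomb(2)[OF assms] .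
  ultimately have "H1_norm \<Omega> (\<lambda>x. a *\<^sub>R u x + b *\<^sub>R v x)
      \<le> sqrt ((\<bar>a\<bar> * ?n u + \<bar>b\<bar> * ?n v)\<^sup>2 + (\<bar>a\<bar> * ?G u + \<bar>b\<bar> * ?G v)\<^sup>2)"
    unfolding H1_norm_def by (intro real_sqrt_le_mono add_mono power_mono) auto
  also have "\<dots> \<le> sqrt ((\<bar>a\<bar> * ?n u)\<^sup>2 + (\<bar>a\<bar> * ?G u)\<^sup>2) + sqrt ((\<bar>b\<bar> * ?n v)\<^sup>2 + (\<bar>b\<bar> * ?G v)\<^sup>2)"
    by (rule real_sqrt_sum_squares_triangle_ineq)
  also have "\<dots> = \<bar>a\<bar> * H1_norm \<Omega> u + \<bar>b\<bar> * H1_norm \<Omega> v"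
    unfolding H1_norm_def hom ..
  finally show ?thesis .
qed

lemma H1_norm_nonneg [simp]: "0 \<le> H1_norm \<Omega> u"
  by (simp add: H1_norm_def)

section \<open>Functions with a prescribed trace\<close>

text \<open>
  Midpoints of approximating sequences approximate the midpoint. On the boundary this uses
  \<open>(a + b)\<^sup>2 / 4 \<le> a\<^sup>2 + b\<^sup>2\<close> under the integral; continuity of \<open>\<phi>\<close> makes the integrands Borel
  measurable, so that the upper bound may be integrated term by term.
\<close>

lemma has_trace_midpoint:
  assumes "open \<Omega>" "bounded \<Omega>" and \<phi>: "continuous_on (frontier \<Omega>) \<phi>"
    and "has_trace \<Omega> u \<phi>" "has_trace \<Omega> v \<phi>"
  shows "has_trace \<Omega> (\<lambda>x. (u x + v x) / 2) \<phi>"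
proof -
  obtain p where p: "\<And>k. p k \<in> H1 \<Omega>" "\<And>k. continuous_on (closure \<Omega>) (p k)"
    "(\<lambda>k. H1_norm \<Omega> (\<lambda>x. p k x - u x)) \<longlonglongrightarrow> 0"
    "(\<lambda>k. \<integral>\<^sup>+x\<in>frontier \<Omega>. ennreal ((p k x - \<phi> x)\<^sup>2) \<partial>hausdorff_measure) \<longlonglongrightarrow> 0"
    and u: "u \<in> H1 \<Omega>"
    using assms(4) unfolding has_trace_def by blast
  obtain q where q: "\<And>k. q k \<in> H1 \<Omega>" "\<And>k. continuous_on (closure \<Omega>) (q k)"
    "(\<lambda>k. H1_norm \<Omega> (\<lambda>x. q k x - v x)) \<longlonglongrightarrow> 0"
    "(\<lambda>k. \<integral>\<^sup>+x\<in>frontier \<Omega>. ennreal ((q k x - \<phi> x)\<^sup>2) \<partial>hausdorff_measure) \<longlonglongrightarrow> 0"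
    and v: "v \<in> H1 \<Omega>"
    using assms(5) unfolding has_trace_def by blast
  let ?m = "\<lambda>k x. (p k x + q k x) / 2"
  have bdry: "(\<lambda>x. ennreal ((r k x - \<phi> x)\<^sup>2) * indicator (frontier \<Omega>) x) \<in> borel_measurable hausdorff_measure"
    if r: "\<And>k. continuous_on (closure \<Omega>) (r k)" for r :: "nat \<Rightarrow> plane \<Rightarrow> real" and k
  proof -
    have "continuous_on (frontier \<Omega>) (\<lambda>x. (r k x - \<phi> x)\<^sup>2)"
      using \<phi> continuous_on_subset[OF r[of k], of "frontier \<Omega>"]
      by (intro continuous_intros) (auto simp: frontier_def)
    then have "(\<lambda>x. indicator (frontier \<Omega>) x *\<^sub>R (r k x - \<phi> x)\<^sup>2) \<in> borel_measurable borel"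
      by (intro borel_measurable_continuous_on_indicator) auto
    then have "(\<lambda>x. ennreal (indicator (frontier \<Omega>) x *\<^sub>R (r k x - \<phi> x)\<^sup>2)) \<in> borel_measurable hausdorff_measure"
      by measurable
    moreover have "ennreal (indicator (frontier \<Omega>) x *\<^sub>R (r k x - \<phi> x)\<^sup>2)
        = ennreal ((r k x - \<phi> x)\<^sup>2) * indicator (frontier \<Omega>) x" for x
      by (auto split: split_indicator)
    ultimately show ?thesis by (simp only:)
  qed
  have "(\<lambda>k. H1_norm \<Omega> (\<lambda>x. ?m k x - (u x + v x) / 2)) \<longlonglongrightarrow> 0"
  proof (rule Lim_null_comparison)
    have "H1_norm \<Omega> (\<lambda>x. ?m k x - (u x + v x) / 2)
        \<le> 1 / 2 * H1_norm \<Omega> (\<lambda>x. p k x - u x) + 1 / 2 * H1_norm \<Omega> (\<lambda>x. q k x - v x)" for k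
    proof -
      have "(\<lambda>x. ?m k x - (u x + v x) / 2) = (\<lambda>x. (1/2) *\<^sub>R (p k x - u x) + (1/2) *\<^sub>R (q k x - v x))"
        by (simp add: field_simps)
      then show ?thesis
        using H1_norm_lincomb[OF assms(1,2) H1_diff(1)[OF assms(1,2) p(1)[of k] u]
            H1_diff(1)[OF assms(1,2) q(1)[of k] v], of "1/2" "1/2"] by simp
    qed
    then show "\<forall>\<^sub>F k in sequentially. norm (H1_norm \<Omega> (\<lambda>x. ?m k x - (u x + v x) / 2))
        \<le> 1 / 2 * H1_norm \<Omega> (\<lambda>x. p k x - u x) + 1 / 2 * H1_norm \<Omega> (\<lambda>x. q k x - v x)"
      by simp
    show "(\<lambda>k. 1 / 2 * H1_norm \<Omega> (\<lambda>x. p k x - u x) + 1 / 2 * H1_norm \<Omega> (\<lambda>x. q k x - v x)) \<longlonglongrightarrow> 0"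
      by (intro tendsto_add_zero tendsto_mult_right_zero p q)
  qed
  moreover have "(\<lambda>k. \<integral>\<^sup>+x\<in>frontier \<Omega>. ennreal ((?m k x - \<phi> x)\<^sup>2) \<partial>hausdorff_measure) \<longlonglongrightarrow> 0"
  proof (rule tendsto_sandwich[OF _ _ tendsto_const])
    let ?P = "\<lambda>r k. \<integral>\<^sup>+x\<in>frontier \<Omega>. ennreal ((r k x - \<phi> x)\<^sup>2) \<partial>hausdorff_measure"
    show "\<forall>\<^sub>F k in sequentially. 0 \<le> ?P ?m k" by simp
    show "(\<lambda>k. ?P p k + ?P q k) \<longlonglongrightarrow> 0"
      using tendsto_add[OF p(4) q(4)] by simp
    have "?P ?m k \<le> ?P p k + ?P q k" for k
    proof -
      have "?P ?m k \<le> (\<integral>\<^sup>+x. ennreal ((p k x - \<phi> x)\<^sup>2) * indicator (frontier \<Omega>) x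
          + ennreal ((q k x - \<phi> x)\<^sup>2) * indicator (frontier \<Omega>) x \<partial>hausdorff_measure)"
      proof (rule nn_integral_mono)
        fix x
        have "0 \<le> ((p k x - \<phi> x)\<^sup>2 + (q k x - \<phi> x)\<^sup>2) / 2 + ((p k x - q k x) / 2)\<^sup>2"
          by simp
        also have "\<dots> = (p k x - \<phi> x)\<^sup>2 + (q k x - \<phi> x)\<^sup>2 - (?m k x - \<phi> x)\<^sup>2"
          by (simp add: power2_eq_square field_simps)
        finally have "(?m k x - \<phi> x)\<^sup>2 \<le> (p k x - \<phi> x)\<^sup>2 + (q k x - \<phi> x)\<^sup>2"
          by (simp only: diff_ge_0_iff_ge)
        then show "ennreal ((?m k x - \<phi> x)\<^sup>2) * indicator (frontier \<Omega>) x
            \<le> ennreal ((p k x - \<phi> x)\<^sup>2) * indicator (frontier \<Omega>) x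
              + ennreal ((q k x - \<phi> x)\<^sup>2) * indicator (frontier \<Omega>) x"
          by (auto split: split_indicator simp flip: ennreal_plus)
      qed
      also have "\<dots> = ?P p k + ?P q k"
        by (rule nn_integral_add) (intro bdry p q)+
      finally show ?thesis .
    qed
    then show "\<forall>\<^sub>F k in sequentially. ?P ?m k \<le> ?P p k + ?P q k" by simp
  qed
  moreover have "continuous_on (closure \<Omega>) (?m k)" for k
    using p(2)[of k] q(2)[of k] by (intro continuous_intros) auto
  ultimately show ?thesis
    unfolding has_trace_def
    using H1_midpoint(1)[OF assms(1,2) u v] H1_midpoint(1)[OF assms(1,2) p(1) q(1)]
    by (intro conjI exI[of _ ?m] allI)
qed

text \<open>
  A diagonal argument: \<open>v n\<close> is replaced by a continuous function that is \<open>1/(n + 1)\<close>-close both in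
  \<open>H\<^sup>1\<close> and on the boundary.
\<close>

lemma has_trace_closed:
  assumes "open \<Omega>" "bounded \<Omega>" "u \<in> H1 \<Omega>" and v: "\<And>n. has_trace \<Omega> (v n) \<phi>"
    and lim: "(\<lambda>n. H1_norm \<Omega> (\<lambda>x. v n x - u x)) \<longlonglongrightarrow> 0"
  shows "has_trace \<Omega> u \<phi>"
proof -
  let ?P = "\<lambda>p. \<integral>\<^sup>+x\<in>frontier \<Omega>. ennreal ((p x - \<phi> x)\<^sup>2) \<partial>hausdorff_measure"
  have v1: "v n \<in> H1 \<Omega>" for n
    using v by (auto simp: has_trace_def)
  let ?Q = "\<lambda>n p. p \<in> H1 \<Omega> \<and> continuous_on (closure \<Omega>) p \<and>
      H1_norm \<Omega> (\<lambda>x. p x - v n x) < inverse (real (Suc n)) \<and> ?P p < ennreal (inverse (real (Suc n)))"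
  have "\<exists>p. ?Q n p" for n
  proof -
    obtain q where q: "\<And>k. q k \<in> H1 \<Omega>" "\<And>k. continuous_on (closure \<Omega>) (q k)"
      "(\<lambda>k. H1_norm \<Omega> (\<lambda>x. q k x - v n x)) \<longlonglongrightarrow> 0" "(\<lambda>k. ?P (q k)) \<longlonglongrightarrow> 0"
      using v[of n] unfolding has_trace_def by blast
    have "\<forall>\<^sub>F k in sequentially. H1_norm \<Omega> (\<lambda>x. q k x - v n x) < inverse (real (Suc n))"
      using q(3) by (rule order_tendstoD) simp
    moreover have "\<forall>\<^sub>F k in sequentially. ?P (q k) < ennreal (inverse (real (Suc n)))"
      using q(4) by (rule order_tendstoD) simp
    ultimately have "\<forall>\<^sub>F k in sequentially. H1_norm \<Omega> (\<lambda>x. q k x - v n x) < inverse (real (Suc n)) \<and>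
        ?P (q k) < ennreal (inverse (real (Suc n)))"
      by (rule eventually_conj)
    then obtain k where "H1_norm \<Omega> (\<lambda>x. q k x - v n x) < inverse (real (Suc n)) \<and>
        ?P (q k) < ennreal (inverse (real (Suc n)))"
      using eventually_happens'[OF sequentially_bot] by blast
    then show ?thesis using q(1,2) by blast
  qed
  then have "\<exists>p. \<forall>n. ?Q n (p n)"
    by (intro choice allI)
  then obtain p where p: "\<And>n. p n \<in> H1 \<Omega>" "\<And>n. continuous_on (closure \<Omega>) (p n)"
    "\<And>n. H1_norm \<Omega> (\<lambda>x. p n x - v n x) < inverse (real (Suc n))"
    "\<And>n. ?P (p n) < ennreal (inverse (real (Suc n)))"
    by blast
  have "(\<lambda>n. H1_norm \<Omega> (\<lambda>x. p n x - u x)) \<longlonglongrightarrow> 0"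
  proof (rule Lim_null_comparison)
    have "H1_norm \<Omega> (\<lambda>x. p n x - u x) \<le> inverse (real (Suc n)) + H1_norm \<Omega> (\<lambda>x. v n x - u x)" for n
      using H1_norm_lincomb[OF assms(1,2) H1_diff(1)[OF assms(1,2) p(1)[of n] v1[of n]]
          H1_diff(1)[OF assms(1,2) v1[of n] assms(3)], of 1 1] p(3)[of n] by simp
    then show "\<forall>\<^sub>F n in sequentially. norm (H1_norm \<Omega> (\<lambda>x. p n x - u x))
        \<le> inverse (real (Suc n)) + H1_norm \<Omega> (\<lambda>x. v n x - u x)"
      by simp
    show "(\<lambda>n. inverse (real (Suc n)) + H1_norm \<Omega> (\<lambda>x. v n x - u x)) \<longlonglongrightarrow> 0"
      using tendsto_add[OF LIMSEQ_inverse_real_of_nat lim] by simp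
  qed
  moreover have "(\<lambda>n. ?P (p n)) \<longlonglongrightarrow> 0"
  proof (rule tendsto_sandwich[OF _ _ tendsto_const])
    show "(\<lambda>n. ennreal (inverse (real (Suc n)))) \<longlonglongrightarrow> 0"
      using tendsto_ennrealI[OF LIMSEQ_inverse_real_of_nat] by simp
    show "\<forall>\<^sub>F n in sequentially. ?P (p n) \<le> ennreal (inverse (real (Suc n)))"
      using p(4) by (intro always_eventually allI less_imp_le)
  qed simp
  ultimately show ?thesis
    unfolding has_trace_def using p(1,2) assms(3) by blast
qed

section \<open>Lower semicontinuity of the Dirichlet integral\<close>

text \<open>
  A substitute for the weak compactness of bounded sets in \<open>H\<^sup>1\<close> followed by Mazur's lemma. Let \<open>D n\<close>
  be the set of those elements of \<open>K\<close> that are \<open>1/(n + 1)\<close>-close to \<open>u\<close> in \<open>L\<^sup>2\<close>, and \<open>d n\<close> the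
  infimum of the Dirichlet integral \<open>G\<close> over \<open>D n\<close>. The sets shrink, so \<open>d\<close> increases; it is bounded,
  because every \<open>D n\<close> contains all but finitely many \<open>w k\<close>; so it has a limit \<open>L\<close>. Choose \<open>v n\<close> in
  \<open>D n\<close> almost minimal. For \<open>n \<le> m\<close> the midpoint of \<open>v n\<close> and \<open>v m\<close> is still in \<open>D n\<close>, and the parallelogram law
  bounds the squared distance of the two gradients by \<open>2 (L - d n) + 4/(n + 1)\<close>. Thus the gradients
  converge strongly, and \<open>v\<close> converges to \<open>u\<close> in \<open>H\<^sup>1\<close>. Moreover \<open>G u \<le> L\<close>, while \<open>d n \<le> G (w k)\<close> for all
  large \<open>k\<close>.
\<close>

lemma strong_approximation_of_L2_limit:
  assumes \<Omega>: "open \<Omega>" "bounded \<Omega>"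
    and K: "K \<subseteq> H1 \<Omega>" "\<And>p q. p \<in> K \<Longrightarrow> q \<in> K \<Longrightarrow> (\<lambda>x. (p x + q x) / 2) \<in> K"
    and w: "\<And>n. w n \<in> K" and u: "u \<in> L2 \<Omega>"
    and lim: "(\<lambda>n. L2_norm \<Omega> (\<lambda>x. w n x - u x)) \<longlonglongrightarrow> 0"
    and bound: "\<And>n. (L2_norm \<Omega> (weak_gradient \<Omega> (w n)))\<^sup>2 \<le> B"
  obtains v where "u \<in> H1 \<Omega>" "\<And>n. v n \<in> K" "(\<lambda>n. H1_norm \<Omega> (\<lambda>x. v n x - u x)) \<longlonglongrightarrow> 0"
    "\<And>e. 0 < e \<Longrightarrow> \<forall>\<^sub>F n in sequentially.
        (L2_norm \<Omega> (weak_gradient \<Omega> u))\<^sup>2 \<le> (L2_norm \<Omega> (weak_gradient \<Omega> (w n)))\<^sup>2 + e"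
proof -
  define G where "G v = (L2_norm \<Omega> (weak_gradient \<Omega> v))\<^sup>2" for v
  define D where "D n = {v \<in> K. L2_norm \<Omega> (\<lambda>x. v x - u x) \<le> inverse (real (Suc n))}" for n
  define d where "d n = (INF v\<in>D n. G v)" for n
  have DH1: "v \<in> H1 \<Omega>" if "v \<in> D n" for v n
    using that K(1) by (auto simp: D_def)
  have w_D: "\<forall>\<^sub>F k in sequentially. w k \<in> D n" for n
  proof -
    have "\<forall>\<^sub>F k in sequentially. L2_norm \<Omega> (\<lambda>x. w k x - u x) < inverse (real (Suc n))"
      using lim by (rule order_tendstoD) simp
    then show ?thesis
      by eventually_elim (simp add: D_def w)
  qed
  then have D_ne: "D n \<noteq> {}" for n
    using eventually_happens'[OF sequentially_bot] by fastforce
  have bdd: "bdd_below (G ` D n)" for n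
    by (rule bdd_belowI[of _ 0]) (auto simp: G_def)
  have d_le: "d n \<le> G v" if "v \<in> D n" for n v
    unfolding d_def using bdd that by (rule cINF_lower)
  have d_bound: "d n \<le> B" for n
  proof -
    obtain k where "w k \<in> D n"
      using eventually_happens'[OF sequentially_bot w_D] by blast
    then show ?thesis
      using d_le[of "w k" n] bound[of k] by (simp add: G_def)
  qed
  have D_anti: "D n \<subseteq> D m" if "m \<le> n" for m n
  proof -
    have "inverse (real (Suc n)) \<le> inverse (real (Suc m))"
      using that by (intro le_imp_inverse_le) auto
    then show ?thesis unfolding D_def using order_trans by blast
  qed
  have "incseq d"
    unfolding d_def incseq_def by (intro allI impI cINF_superset_mono D_ne bdd D_anti) auto
  then obtain L where L: "d \<longlonglongrightarrow> L" "\<And>n. d n \<le> L"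
    using incseq_convergent[of d B] d_bound by blast
  have "\<exists>v. v \<in> D n \<and> G v < d n + inverse (real (Suc n))" for n
    using cINF_less_iff[OF D_ne bdd, of n "d n + inverse (real (Suc n))"] unfolding d_def by auto
  then obtain v where v: "\<And>n. v n \<in> D n" "\<And>n. G (v n) < d n + inverse (real (Suc n))"
    by metis
  have vH1: "v n \<in> H1 \<Omega>" for n using DH1 v(1) .
  define g where "g n = weak_gradient \<Omega> (v n)" for n
  have gL2: "g n \<in> L2 \<Omega>" for n
    unfolding g_def using vH1 by (rule weak_gradient_L2)
  define \<eta> where "\<eta> n = 2 * (L - d n) + 4 * inverse (real (Suc n))" for n
  have near: "(L2_norm \<Omega> (\<lambda>x. g m x - g n x))\<^sup>2 \<le> \<eta> n" if "n \<le> m" for m n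
  proof -
    have vmD: "v m \<in> D n" using v(1) D_anti[OF that] by blast
    let ?p = "\<lambda>x. (v m x + v n x) / 2"
    have "?p \<in> D n"
    proof -
      have "L2_norm \<Omega> (\<lambda>x. ?p x - u x)
          = L2_norm \<Omega> (\<lambda>x. (1/2) *\<^sub>R (v m x - u x) + (1/2) *\<^sub>R (v n x - u x))"
        by (rule arg_cong[where f = "L2_norm \<Omega>"]) (auto simp: field_simps)
      also have "\<dots> \<le> L2_norm \<Omega> (\<lambda>x. (1/2) *\<^sub>R (v m x - u x)) + L2_norm \<Omega> (\<lambda>x. (1/2) *\<^sub>R (v n x - u x))"
        by (intro L2_norm_triangle L2_scaleR L2_diff H1_L2 vH1 u)
      also have "\<dots> \<le> inverse (real (Suc n))"
        unfolding L2_norm_scaleR using vmD v(1)[of n] by (simp add: D_def)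
      finally show ?thesis
        using K(2) vmD v(1)[of n] by (simp add: D_def)
    qed
    then have "d n \<le> G ?p" by (rule d_le)
    moreover have "(L2_norm \<Omega> (\<lambda>x. g m x - g n x))\<^sup>2 + 4 * G ?p = 2 * G (v m) + 2 * G (v n)"
      using L2_parallelogram[OF gL2 gL2, of m n] H1_midpoint(2)[OF \<Omega> vH1 vH1, of m n]
      by (simp add: G_def g_def)
    moreover have "inverse (real (Suc m)) \<le> inverse (real (Suc n))"
      using that by (intro le_imp_inverse_le) auto
    moreover have "Q \<le> 2 * (L - dn) + 4 * i" if "dn \<le> p" "Q + 4 * p = 2 * a + 2 * b" "j \<le> i"
      "a < dm + j" "b < dn + i" "dm \<le> L" for Q p a b dm dn i j :: real
      using that by argo
    ultimately show ?thesis
      unfolding \<eta>_def using v(2)[of m] v(2)[of n] L(2)[of m] by blast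
  qed
  have "\<eta> \<longlonglongrightarrow> 2 * (L - L) + 4 * 0"
    unfolding \<eta>_def by (intro tendsto_intros L LIMSEQ_inverse_real_of_nat)
  then have \<eta>0: "\<eta> \<longlonglongrightarrow> 0" by simp
  have "\<exists>N. \<forall>m\<ge>N. \<forall>n\<ge>N. L2_norm \<Omega> (\<lambda>x. g m x - g n x) < e" if e: "0 < e" for e
  proof -
    have "\<forall>\<^sub>F n in sequentially. \<eta> n < e\<^sup>2"
      using \<eta>0 by (rule order_tendstoD) (use e in simp)
    then obtain N where N: "\<And>n. N \<le> n \<Longrightarrow> \<eta> n < e\<^sup>2"
      by (auto simp: eventually_sequentially)
    have *: "L2_norm \<Omega> (\<lambda>x. g m x - g n x) < e" if "N \<le> n" "n \<le> m" for m n
    proof (rule power2_less_imp_less)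
      show "(L2_norm \<Omega> (\<lambda>x. g m x - g n x))\<^sup>2 < e\<^sup>2"
        using near[OF that(2)] N[OF that(1)] by simp
    qed (use e in simp)
    have "L2_norm \<Omega> (\<lambda>x. g m x - g n x) < e" if "N \<le> n" "N \<le> m" for m n
      using *[of n m] *[of m n] that L2_norm_minus_commute[of \<Omega> "g m" "g n"] by (metis linear)
    then show ?thesis by blast
  qed
  then obtain h where h: "h \<in> L2 \<Omega>" "(\<lambda>n. L2_norm \<Omega> (\<lambda>x. g n x - h x)) \<longlonglongrightarrow> 0"
    using L2_complete[OF \<Omega>, of g] gL2 by blast
  have vu: "(\<lambda>n. L2_norm \<Omega> (\<lambda>x. v n x - u x)) \<longlonglongrightarrow> 0"
    using v(1) by (intro Lim_null_comparison[OF _ LIMSEQ_inverse_real_of_nat]) (simp add: D_def)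
  have vg: "has_weak_gradient \<Omega> (v n) (g n)" for n
    unfolding g_def using vH1 by (rule H1_has_weak_gradient)
  have uh: "has_weak_gradient \<Omega> u h"
    by (rule has_weak_gradient_limit[OF \<Omega> H1_L2[OF vH1] u h(1) vg vu h(2)])
  then have uH1: "u \<in> H1 \<Omega>"
    using u by (auto simp: H1_def)
  have "L2_norm \<Omega> (weak_gradient \<Omega> (\<lambda>x. v n x - u x)) = L2_norm \<Omega> (\<lambda>x. g n x - h x)" for n
    using has_weak_gradient_lincomb[OF \<Omega> H1_L2[OF vH1] u vg uh, of 1 n "-1"]
    by (intro L2_norm_weak_gradient[OF \<Omega>] L2_diff H1_L2 vH1 u) simp
  then have "H1_norm \<Omega> (\<lambda>x. v n x - u x)
      = sqrt ((L2_norm \<Omega> (\<lambda>x. v n x - u x))\<^sup>2 + (L2_norm \<Omega> (\<lambda>x. g n x - h x))\<^sup>2)" for n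
    by (simp add: H1_norm_def)
  moreover have "(\<lambda>n. sqrt ((L2_norm \<Omega> (\<lambda>x. v n x - u x))\<^sup>2 + (L2_norm \<Omega> (\<lambda>x. g n x - h x))\<^sup>2))
      \<longlonglongrightarrow> sqrt (0\<^sup>2 + 0\<^sup>2)"
    by (intro tendsto_intros vu h(2))
  ultimately have H1lim: "(\<lambda>n. H1_norm \<Omega> (\<lambda>x. v n x - u x)) \<longlonglongrightarrow> 0" by simp
  (* the norm of g n is at most sqrt (L + 1/(n + 1)), and g tends to h *)
  have "L2_norm \<Omega> h \<le> sqrt (L + 0) + 0"
  proof (rule LIMSEQ_le_const)
    show "(\<lambda>n. sqrt (L + inverse (real (Suc n))) + L2_norm \<Omega> (\<lambda>x. g n x - h x)) \<longlonglongrightarrow> sqrt (L + 0) + 0"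
      by (intro tendsto_intros LIMSEQ_inverse_real_of_nat h)
    have "L2_norm \<Omega> h \<le> sqrt (L + inverse (real (Suc n))) + L2_norm \<Omega> (\<lambda>x. g n x - h x)" for n
    proof -
      have "(L2_norm \<Omega> (g n))\<^sup>2 \<le> L + inverse (real (Suc n))"
        using v(2)[of n] L(2)[of n] by (simp add: G_def g_def)
      then have "L2_norm \<Omega> (g n) \<le> sqrt (L + inverse (real (Suc n)))"
        by (rule real_le_rsqrt)
      moreover have "L2_norm \<Omega> h \<le> L2_norm \<Omega> (g n) + L2_norm \<Omega> (\<lambda>x. h x - g n x)"
        using L2_norm_triangle[OF gL2 L2_diff[OF h(1) gL2], of n n] by simp
      ultimately show ?thesis
        using L2_norm_minus_commute[of \<Omega> h "g n"] by simp
    qed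
    then show "\<exists>N. \<forall>n\<ge>N. L2_norm \<Omega> h \<le> sqrt (L + inverse (real (Suc n))) + L2_norm \<Omega> (\<lambda>x. g n x - h x)"
      by blast
  qed
  moreover have "0 \<le> L"
  proof -
    have "0 \<le> d 0" unfolding d_def by (intro cINF_greatest D_ne) (simp add: G_def)
    then show ?thesis using L(2)[of 0] by simp
  qed
  ultimately have GL: "G u \<le> L"
    unfolding G_def L2_norm_weak_gradient[OF \<Omega> u uh]
    using power_mono[of "L2_norm \<Omega> h" "sqrt L" 2] by simp
  have lsc: "\<forall>\<^sub>F k in sequentially. G u \<le> G (w k) + e" if "0 < e" for e
  proof -
    have "\<forall>\<^sub>F n in sequentially. L - e < d n"
      using L(1) by (rule order_tendstoD) (use that in simp)
    then obtain n where n: "L - e < d n"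
      using eventually_happens'[OF sequentially_bot] by blast
    show ?thesis
      using w_D[of n] by eventually_elim (use d_le n GL in fastforce)
  qed
  show thesis
  proof (rule that[of v])
    show "v n \<in> K" for n using v(1)[of n] by (simp add: D_def)
  qed (use uH1 H1lim lsc in \<open>auto simp: G_def\<close>)
qed

section \<open>The energies along a converging sequence\<close>

lemma dirichlet_energy_eq:
  assumes "\<And>i. u i \<in> H1 \<Omega>"
  shows "(\<integral>\<^sup>+x. ennreal (\<Sum>i\<in>(UNIV::3 set). (norm (weak_gradient \<Omega> (u i) x))\<^sup>2) \<partial>lebesgue_on \<Omega>)
    = ennreal (\<Sum>i\<in>UNIV. (L2_norm \<Omega> (weak_gradient \<Omega> (u i)))\<^sup>2)"
  using L2_integrable_norm_sq[OF weak_gradient_L2[OF assms]]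
  by (subst nn_integral_eq_integral) (auto simp: L2_norm_sq intro!: sum_nonneg)

lemma admissibleD:
  assumes "u \<in> admissible \<Omega> \<phi>"
  shows "u i \<in> H1 \<Omega>" "AE x in lebesgue_on \<Omega>. 0 \<le> u i x" "has_trace \<Omega> (u i) (\<phi> i)"
  using assms by (auto simp: admissible_def)

lemma dirichlet_le_penalized_energy:
  assumes "u \<in> admissible \<Omega> \<phi>" "0 < \<epsilon>"
  shows "ennreal (\<Sum>i\<in>UNIV. (L2_norm \<Omega> (weak_gradient \<Omega> (u i)))\<^sup>2) \<le> penalized_energy \<Omega> \<phi> \<epsilon> u"
proof -
  have "ennreal (\<Sum>i\<in>UNIV. (L2_norm \<Omega> (weak_gradient \<Omega> (u i)))\<^sup>2)
      = (\<integral>\<^sup>+x. ennreal (\<Sum>i\<in>UNIV. (norm (weak_gradient \<Omega> (u i) x))\<^sup>2) \<partial>lebesgue_on \<Omega>)"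
    using dirichlet_energy_eq[of u \<Omega>] admissibleD(1)[OF assms(1)] by simp
  also have "\<dots> \<le> penalized_energy \<Omega> \<phi> \<epsilon> u"
    unfolding penalized_energy_def using assms by (auto intro!: nn_integral_mono ennreal_leI)
  finally show ?thesis .
qed

lemma measurable_prod_sq:
  assumes "\<And>i. u i \<in> L2 \<Omega>"
  shows "(\<lambda>x. ennreal ((\<Prod>i\<in>(UNIV::3 set). u i x)\<^sup>2)) \<in> borel_measurable (lebesgue_on \<Omega>)"
  using L2_measurable[OF assms] by measurable

text \<open>
  The penalty term forces the product to be small: a bounded energy leaves at most a multiple of
  \<open>\<epsilon>\<close> for its square integral.
\<close>

lemma product_le_penalized_energy:
  assumes "u \<in> admissible \<Omega> \<phi>" "0 < \<epsilon>"
  shows "(\<integral>\<^sup>+x. ennreal ((\<Prod>i\<in>UNIV. u i x)\<^sup>2) \<partial>lebesgue_on \<Omega>) \<le> ennreal \<epsilon> * penalized_energy \<Omega> \<phi> \<epsilon> u"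
proof -
  note meas = measurable_prod_sq[OF H1_L2[OF admissibleD(1)[OF assms(1)]]]
  have "ennreal ((\<Prod>i\<in>UNIV. u i x)\<^sup>2) = ennreal \<epsilon> * (ennreal (1 / \<epsilon>) * ennreal ((\<Prod>i\<in>UNIV. u i x)\<^sup>2))" for x
    using assms(2) by (simp flip: ennreal_mult)
  then have "(\<integral>\<^sup>+x. ennreal ((\<Prod>i\<in>UNIV. u i x)\<^sup>2) \<partial>lebesgue_on \<Omega>)
      = (\<integral>\<^sup>+x. ennreal \<epsilon> * (ennreal (1 / \<epsilon>) * ennreal ((\<Prod>i\<in>UNIV. u i x)\<^sup>2)) \<partial>lebesgue_on \<Omega>)"
    by (simp only:)
  also have "\<dots> = ennreal \<epsilon> * (\<integral>\<^sup>+x. ennreal (1 / \<epsilon>) * ennreal ((\<Prod>i\<in>UNIV. u i x)\<^sup>2) \<partial>lebesgue_on \<Omega>)"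
    using meas by (intro nn_integral_cmult borel_measurable_times_ennreal) auto
  also have "\<dots> \<le> ennreal \<epsilon> * penalized_energy \<Omega> \<phi> \<epsilon> u"
    unfolding penalized_energy_def using assms
    by (auto intro!: mult_left_mono nn_integral_mono ennreal_leI sum_nonneg simp flip: ennreal_mult)
  finally show ?thesis .
qed

text \<open>
  Summing the squared differences first gives one subsequence that works for all components at once.
\<close>

lemma L2_tendsto_AE_subseq:
  assumes "\<And>n i. w n i \<in> L2 \<Omega>" "\<And>i. u i \<in> L2 \<Omega>" "L2_tendsto \<Omega> w u"
  obtains r where "strict_mono r" "AE x in lebesgue_on \<Omega>. \<forall>i. (\<lambda>n. w (r n) i x) \<longlonglongrightarrow> u i x"
proof -
  define f where "f n x = (\<Sum>i\<in>UNIV. (w n i x - u i x)\<^sup>2)" for n x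
  have int: "integrable (lebesgue_on \<Omega>) (\<lambda>x. (w n i x - u i x)\<^sup>2)" for n i
    using L2_integrable_norm_sq[OF L2_diff[OF assms(1,2)], of n i i] by simp
  have fi: "integrable (lebesgue_on \<Omega>) (f n)" for n
    unfolding f_def by (intro Bochner_Integration.integrable_sum int)
  have "norm (f n x) = f n x" for n x
    by (simp add: f_def sum_nonneg)
  then have "(\<integral>x. norm (f n x) \<partial>lebesgue_on \<Omega>) = (\<Sum>i\<in>UNIV. (L2_norm \<Omega> (\<lambda>x. w n i x - u i x))\<^sup>2)" for n
    by (simp add: f_def L2_norm_sq int)
  moreover have "(\<lambda>n. \<Sum>i\<in>(UNIV::3 set). (L2_norm \<Omega> (\<lambda>x. w n i x - u i x))\<^sup>2) \<longlonglongrightarrow> (\<Sum>i\<in>(UNIV::3 set). 0\<^sup>2)"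
    using assms(3) unfolding L2_tendsto_def by (intro tendsto_sum tendsto_power) auto
  ultimately have "(\<lambda>n. \<integral>x. norm (f n x) \<partial>lebesgue_on \<Omega>) \<longlonglongrightarrow> 0" by simp
  from tendsto_L1_AE_subseq[OF fi this] obtain r where r: "strict_mono r"
    and ae: "AE x in lebesgue_on \<Omega>. (\<lambda>n. f (r n) x) \<longlonglongrightarrow> 0"
    by blast
  have "AE x in lebesgue_on \<Omega>. \<forall>i. (\<lambda>n. w (r n) i x) \<longlonglongrightarrow> u i x"
    using ae
  proof (eventually_elim, intro allI)
    fix x i assume lim: "(\<lambda>n. f (r n) x) \<longlonglongrightarrow> 0"
    have "(w n i x - u i x)\<^sup>2 \<le> f n x" for n
      unfolding f_def by (rule member_le_sum) auto
    then have "(\<lambda>n. (w (r n) i x - u i x)\<^sup>2) \<longlonglongrightarrow> 0"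
      by (intro Lim_null_comparison[OF _ lim]) simp
    then have "(\<lambda>n. sqrt ((w (r n) i x - u i x)\<^sup>2)) \<longlonglongrightarrow> sqrt 0"
      by (rule tendsto_real_sqrt)
    then show "(\<lambda>n. w (r n) i x) \<longlonglongrightarrow> u i x"
      by (simp add: tendsto_rabs_zero_iff LIM_zero_iff)
  qed
  then show thesis using r that by blast
qed

text \<open>
  The product of three \<open>L\<^sup>2\<close> functions need not be integrable, so the constraint is passed to the limit
  pointwise, and Fatou's lemma controls the integral.
\<close>

lemma AE_product_zero_of_limit:
  assumes w: "\<And>n i. w n i \<in> L2 \<Omega>" and u: "\<And>i. u i \<in> L2 \<Omega>"
    and lim: "AE x in lebesgue_on \<Omega>. \<forall>i. (\<lambda>n. w n i x) \<longlonglongrightarrow> u i x"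
    and zero: "(\<lambda>n. \<integral>\<^sup>+x. ennreal ((\<Prod>i\<in>(UNIV::3 set). w n i x)\<^sup>2) \<partial>lebesgue_on \<Omega>) \<longlonglongrightarrow> 0"
  shows "AE x in lebesgue_on \<Omega>. (\<Prod>i\<in>UNIV. u i x) = 0"
proof -
  have "(\<integral>\<^sup>+x. ennreal ((\<Prod>i\<in>UNIV. u i x)\<^sup>2) \<partial>lebesgue_on \<Omega>)
      = (\<integral>\<^sup>+x. liminf (\<lambda>n. ennreal ((\<Prod>i\<in>UNIV. w n i x)\<^sup>2)) \<partial>lebesgue_on \<Omega>)"
  proof (rule nn_integral_cong_AE)
    show "AE x in lebesgue_on \<Omega>. ennreal ((\<Prod>i\<in>UNIV. u i x)\<^sup>2) = liminf (\<lambda>n. ennreal ((\<Prod>i\<in>UNIV. w n i x)\<^sup>2))"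
      using lim
    proof eventually_elim
      case (elim x)
      then have "(\<lambda>n. ennreal ((\<Prod>i\<in>UNIV. w n i x)\<^sup>2)) \<longlonglongrightarrow> ennreal ((\<Prod>i\<in>UNIV. u i x)\<^sup>2)"
        by (intro tendsto_ennrealI tendsto_power tendsto_prod) auto
      from lim_imp_Liminf[OF sequentially_bot this] show ?case by simp
    qed
  qed
  also have "\<dots> \<le> liminf (\<lambda>n. \<integral>\<^sup>+x. ennreal ((\<Prod>i\<in>UNIV. w n i x)\<^sup>2) \<partial>lebesgue_on \<Omega>)"
    by (intro nn_integral_liminf measurable_prod_sq w)
  also have "\<dots> = 0"
    using zero by (rule lim_imp_Liminf[OF sequentially_bot])
  finally have "AE x in lebesgue_on \<Omega>. ennreal ((\<Prod>i\<in>UNIV. u i x)\<^sup>2) = 0"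
    using measurable_prod_sq[OF u] by (simp add: nn_integral_0_iff_AE)
  then show ?thesis
    by eventually_elim (simp del: prod_eq_1_iff add: ennreal_eq_0_iff)
qed

section \<open>The two inequalities of \<open>\<Gamma>\<close>-convergence\<close>

text \<open>
  Only a finite lower limit has to be treated. On a subsequence that realises it the energies are
  bounded, hence all its members are admissible and have bounded Dirichlet integrals, and their
  products tend to zero in \<open>L\<^sup>2\<close>. The set of functions with trace \<open>\<phi> i\<close> is midpoint convex and closed
  in \<open>H\<^sup>1\<close>, so the limit has this trace and no larger Dirichlet integral, component by component. The
  signs and the constraint \<open>u\<^sub>1 u\<^sub>2 u\<^sub>3 = 0\<close> survive because a further subsequence converges almost
  everywhere.
\<close>

lemma constrained_energy_le_liminf:
  assumes \<Omega>: "open \<Omega>" "bounded \<Omega>" and \<phi>: "\<And>i. continuous_on (frontier \<Omega>) (\<phi> i)"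
    and \<epsilon>: "\<And>n. 0 < \<epsilon> n" "\<epsilon> \<longlonglongrightarrow> 0"
    and u: "\<And>i. u i \<in> L2 \<Omega>" and w: "\<And>n i. w n i \<in> L2 \<Omega>" and wu: "L2_tendsto \<Omega> w u"
  shows "constrained_energy \<Omega> \<phi> u \<le> liminf (\<lambda>n. penalized_energy \<Omega> \<phi> (\<epsilon> n) (w n))"
    (is "_ \<le> ?L")
proof (cases "?L = \<infinity>")
  case False
  define E where "E n = penalized_energy \<Omega> \<phi> (\<epsilon> n) (w n)" for n
  define B where "B = enn2real ?L + 1"
  have "?L < ennreal B"
    using False unfolding B_def
    by (cases ?L) (auto simp: ennreal_less_iff)
  obtain r0 where r0: "strict_mono r0" "(E \<circ> r0) \<longlonglongrightarrow> ?L"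
    using liminf_subseq_lim[of E] unfolding E_def by blast
  then have "\<forall>\<^sub>F n in sequentially. E (r0 n) < ennreal B"
    using order_tendstoD(2)[OF r0(2) \<open>?L < ennreal B\<close>] by simp
  then obtain N where N: "\<And>n. N \<le> n \<Longrightarrow> E (r0 n) < ennreal B"
    by (auto simp: eventually_sequentially)
  (* dropping the first N members makes the energy bound hold for all indices *)
  define r where "r n = r0 (n + N)" for n
  have r: "strict_mono r"
    using r0(1) by (auto simp: r_def strict_mono_def)
  have E_lim: "(\<lambda>n. E (r n)) \<longlonglongrightarrow> ?L"
    using LIMSEQ_ignore_initial_segment[OF r0(2), of N] by (simp add: r_def)
  have E_B: "E (r n) < ennreal B" for n
    using N by (simp add: r_def)
  have adm: "w (r n) \<in> admissible \<Omega> \<phi>" for n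
    using E_B[of n] by (auto simp: E_def penalized_energy_def split: if_splits)
  define G where "G v = (L2_norm \<Omega> (weak_gradient \<Omega> v))\<^sup>2" for v
  have G_E: "ennreal (\<Sum>i\<in>UNIV. G (w (r n) i)) \<le> E (r n)" for n
    unfolding E_def G_def using adm \<epsilon>(1) by (rule dirichlet_le_penalized_energy)
  have B0: "0 \<le> B" by (simp add: B_def)
  have G_B: "G (w (r n) i) \<le> B" for n i
  proof -
    have "ennreal (\<Sum>i\<in>UNIV. G (w (r n) i)) \<le> ennreal B"
      using G_E[of n] E_B[of n] by simp
    then have "(\<Sum>i\<in>UNIV. G (w (r n) i)) \<le> B"
      using B0 by (simp only: ennreal_le_iff)
    moreover have "G (w (r n) i) \<le> (\<Sum>i\<in>UNIV. G (w (r n) i))"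
      by (rule member_le_sum) (auto simp: G_def)
    ultimately show ?thesis by simp
  qed
  have wu_r: "L2_tendsto \<Omega> (\<lambda>n. w (r n)) u"
    unfolding L2_tendsto_def
  proof
    fix i
    show "(\<lambda>n. L2_norm \<Omega> (\<lambda>x. w (r n) i x - u i x)) \<longlonglongrightarrow> 0"
      using LIMSEQ_subseq_LIMSEQ[OF _ r, of "\<lambda>n. L2_norm \<Omega> (\<lambda>x. w n i x - u i x)" 0] wu
      by (simp add: L2_tendsto_def o_def)
  qed
  have component: "has_trace \<Omega> (u i) (\<phi> i) \<and>
      (\<forall>e>0. \<forall>\<^sub>F n in sequentially. G (u i) \<le> G (w (r n) i) + e)" for i
  proof -
    have tr: "w (r n) i \<in> {v. has_trace \<Omega> v (\<phi> i)}" for n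
      using admissibleD(3)[OF adm] by simp
    have K: "{v. has_trace \<Omega> v (\<phi> i)} \<subseteq> H1 \<Omega>"
      by (auto simp: has_trace_def)
    have mid: "(\<lambda>x. (p x + q x) / 2) \<in> {v. has_trace \<Omega> v (\<phi> i)}"
      if "p \<in> {v. has_trace \<Omega> v (\<phi> i)}" "q \<in> {v. has_trace \<Omega> v (\<phi> i)}" for p q
      using has_trace_midpoint[OF \<Omega> \<phi>] that by simp
    have lim: "(\<lambda>n. L2_norm \<Omega> (\<lambda>x. w (r n) i x - u i x)) \<longlonglongrightarrow> 0"
      using wu_r by (simp add: L2_tendsto_def)
    obtain v where v: "u i \<in> H1 \<Omega>" "\<And>n. v n \<in> {v. has_trace \<Omega> v (\<phi> i)}"
      "(\<lambda>n. H1_norm \<Omega> (\<lambda>x. v n x - u i x)) \<longlonglongrightarrow> 0"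
      "\<And>e. 0 < e \<Longrightarrow> \<forall>\<^sub>F n in sequentially. G (u i) \<le> G (w (r n) i) + e"
      using strong_approximation_of_L2_limit[OF \<Omega> K mid tr u lim G_B[unfolded G_def]]
      unfolding G_def by blast
    then show ?thesis
      using has_trace_closed[OF \<Omega> v(1) _ v(3)] by blast
  qed
  have uH1: "u i \<in> H1 \<Omega>" for i
    using component by (auto simp: has_trace_def)
  obtain s where s: "strict_mono s"
    and ae: "AE x in lebesgue_on \<Omega>. \<forall>i. (\<lambda>n. w (r (s n)) i x) \<longlonglongrightarrow> u i x"
    using L2_tendsto_AE_subseq[OF w u wu_r] by blast
  (* countably many null sets are discarded at once before letting n tend to infinity *)
  have "AE x in lebesgue_on \<Omega>. \<forall>n i. 0 \<le> w (r (s n)) i x"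
    using admissibleD(2)[OF adm] by (simp add: AE_all_countable)
  with ae have "AE x in lebesgue_on \<Omega>. \<forall>i. 0 \<le> u i x"
    by eventually_elim (blast intro: LIMSEQ_le_const)
  then have nonneg: "AE x in lebesgue_on \<Omega>. 0 \<le> u i x" for i
    by eventually_elim simp
  have "(\<lambda>n. \<integral>\<^sup>+x. ennreal ((\<Prod>i\<in>UNIV. w (r (s n)) i x)\<^sup>2) \<partial>lebesgue_on \<Omega>) \<longlonglongrightarrow> 0"
  proof (rule tendsto_sandwich[OF _ _ tendsto_const])
    have "(\<lambda>n. \<epsilon> (r (s n)) * B) \<longlonglongrightarrow> 0 * B"
      using LIMSEQ_subseq_LIMSEQ[OF \<epsilon>(2) strict_mono_o[OF r s]]
      by (intro tendsto_mult tendsto_const) (simp add: o_def)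
    from tendsto_ennrealI[OF this] show "(\<lambda>n. ennreal (\<epsilon> (r (s n)) * B)) \<longlonglongrightarrow> 0" by simp
    have "(\<integral>\<^sup>+x. ennreal ((\<Prod>i\<in>UNIV. w (r (s n)) i x)\<^sup>2) \<partial>lebesgue_on \<Omega>) \<le> ennreal (\<epsilon> (r (s n)) * B)" for n
    proof -
      have "(\<integral>\<^sup>+x. ennreal ((\<Prod>i\<in>UNIV. w (r (s n)) i x)\<^sup>2) \<partial>lebesgue_on \<Omega>)
          \<le> ennreal (\<epsilon> (r (s n))) * E (r (s n))"
        unfolding E_def using adm \<epsilon>(1) by (rule product_le_penalized_energy)
      also have "\<dots> \<le> ennreal (\<epsilon> (r (s n))) * ennreal B"
        by (rule mult_left_mono[OF less_imp_le[OF E_B]]) simp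
      also have "\<dots> = ennreal (\<epsilon> (r (s n)) * B)"
        using \<epsilon>(1) B0 by (simp add: ennreal_mult less_imp_le)
      finally show ?thesis .
    qed
    then show "\<forall>\<^sub>F n in sequentially.
        (\<integral>\<^sup>+x. ennreal ((\<Prod>i\<in>UNIV. w (r (s n)) i x)\<^sup>2) \<partial>lebesgue_on \<Omega>) \<le> ennreal (\<epsilon> (r (s n)) * B)"
      by (intro always_eventually allI)
  qed simp
  from AE_product_zero_of_limit[OF w u ae this]
  have "u \<in> segregated \<Omega> \<phi>"
    using uH1 nonneg component by (simp add: segregated_def admissible_def)
  then have "constrained_energy \<Omega> \<phi> u = ennreal (\<Sum>i\<in>UNIV. G (u i))"
    using dirichlet_energy_eq[of u \<Omega>] uH1 by (simp add: constrained_energy_def G_def)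
  also have "\<dots> \<le> ?L"
  proof (rule ennreal_le_epsilon)
    fix e :: real assume "0 < e"
    (* the error is split among the three components *)
    have "\<forall>\<^sub>F n in sequentially. \<forall>i. G (u i) \<le> G (w (r n) i) + e / 3"
      using component \<open>0 < e\<close> by (intro eventually_all_finite) auto
    then have "\<forall>\<^sub>F n in sequentially. ennreal (\<Sum>i\<in>UNIV. G (u i)) \<le> E (r n) + ennreal e"
    proof eventually_elim
      case (elim n)
      then have "(\<Sum>i\<in>UNIV. G (u i)) \<le> (\<Sum>i\<in>(UNIV::3 set). G (w (r n) i) + e / 3)"
        by (intro sum_mono) simp
      also have "\<dots> = (\<Sum>i\<in>UNIV. G (w (r n) i)) + e"
        by (simp add: sum.distrib)
      finally have "ennreal (\<Sum>i\<in>UNIV. G (u i)) \<le> ennreal ((\<Sum>i\<in>UNIV. G (w (r n) i)) + e)"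
        by (rule ennreal_leI)
      also have "\<dots> = ennreal (\<Sum>i\<in>UNIV. G (w (r n) i)) + ennreal e"
        using \<open>0 < e\<close> by (intro ennreal_plus sum_nonneg) (auto simp: G_def)
      also have "\<dots> \<le> E (r n) + ennreal e"
        by (rule add_right_mono[OF G_E])
      finally show ?case .
    qed
    then show "ennreal (\<Sum>i\<in>UNIV. G (u i)) \<le> ?L + ennreal e"
      by (rule tendsto_lowerbound[OF tendsto_add[OF E_lim tendsto_const] _ sequentially_bot])
  qed
  finally show ?thesis .
qed simp

lemma penalized_energy_segregated:
  assumes "u \<in> segregated \<Omega> \<phi>"
  shows "penalized_energy \<Omega> \<phi> \<epsilon> u = constrained_energy \<Omega> \<phi> u"
proof -
  have "u \<in> admissible \<Omega> \<phi>" and ae: "AE x in lebesgue_on \<Omega>. (\<Prod>i\<in>UNIV. u i x) = 0"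
    using assms by (auto simp: segregated_def)
  moreover have "(\<integral>\<^sup>+x. ennreal ((\<Sum>i\<in>UNIV. (norm (weak_gradient \<Omega> (u i) x))\<^sup>2)
        + 1 / \<epsilon> * (\<Prod>i\<in>UNIV. u i x)\<^sup>2) \<partial>lebesgue_on \<Omega>)
      = (\<integral>\<^sup>+x. ennreal (\<Sum>i\<in>UNIV. (norm (weak_gradient \<Omega> (u i) x))\<^sup>2) \<partial>lebesgue_on \<Omega>)"
    using ae by (intro nn_integral_cong_AE, eventually_elim) (simp only: mult_zero_right power_zero_numeral add_0_right)
  ultimately show ?thesis
    using assms by (simp add: penalized_energy_def constrained_energy_def)
qed

lemma C1_holder_on_imp_continuous_on: "C1_holder_on \<alpha> S \<phi> \<Longrightarrow> continuous_on S \<phi>"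
proof -
  assume "C1_holder_on \<alpha> S \<phi>"
  then obtain \<Phi> G where "\<And>x. (\<Phi> has_derivative (\<lambda>h. G x \<bullet> h)) (at x)" "\<And>x. x \<in> S \<Longrightarrow> \<Phi> x = \<phi> x"
    unfolding C1_holder_on_def by blast
  moreover from this(1) have "continuous_on S \<Phi>"
    by (intro has_derivative_continuous_on[OF has_derivative_at_withinI])
  ultimately show ?thesis
    by (simp cong: continuous_on_cong)
qed

theorem theorem3p1:
  fixes \<Omega> :: "(real ^ 2) set" and \<phi> :: "3 \<Rightarrow> real ^ 2 \<Rightarrow> real" and \<alpha> :: real
  assumes "lipschitz_domain \<Omega>"
    and "0 < \<alpha>" and "\<alpha> < 1"
    and "\<And>i. C1_holder_on \<alpha> (frontier \<Omega>) (\<phi> i)"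
    and "\<And>i x. x \<in> frontier \<Omega> \<Longrightarrow> 0 \<le> \<phi> i x"
    and "\<And>x. x \<in> frontier \<Omega> \<Longrightarrow> (\<Prod>i\<in>UNIV. \<phi> i x) = 0"
  shows "Gamma_converges \<Omega> (penalized_energy \<Omega> \<phi>) (constrained_energy \<Omega> \<phi>)"
  unfolding Gamma_converges_def
proof (intro allI impI conjI)
  have \<Omega>: "open \<Omega>" "bounded \<Omega>"
    using assms(1) by (auto simp: lipschitz_domain_def)
  have \<phi>: "continuous_on (frontier \<Omega>) (\<phi> i)" for i
    using assms(4) by (rule C1_holder_on_imp_continuous_on)
  fix \<epsilon> :: "nat \<Rightarrow> real" and u :: "3 \<Rightarrow> plane \<Rightarrow> real"
  assume \<epsilon>: "\<forall>n. 0 < \<epsilon> n" "\<epsilon> \<longlonglongrightarrow> 0" and u: "\<forall>i. u i \<in> L2 \<Omega>"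
  {
    fix w :: "nat \<Rightarrow> 3 \<Rightarrow> plane \<Rightarrow> real"
    assume "\<forall>n i. w n i \<in> L2 \<Omega>" "L2_tendsto \<Omega> w u"
    then show "constrained_energy \<Omega> \<phi> u \<le> liminf (\<lambda>n. penalized_energy \<Omega> \<phi> (\<epsilon> n) (w n))"
      using \<epsilon> u by (intro constrained_energy_le_liminf \<Omega> \<phi>) auto
  }
  (* the constant sequence recovers the energy, since the penalty vanishes on segregated triples *)
  show "\<exists>w. (\<forall>n i. w n i \<in> L2 \<Omega>) \<and> L2_tendsto \<Omega> w u \<and>
      limsup (\<lambda>n. penalized_energy \<Omega> \<phi> (\<epsilon> n) (w n)) \<le> constrained_energy \<Omega> \<phi> u"
  proof (intro exI[of _ "\<lambda>n. u"] conjI)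
    show "L2_tendsto \<Omega> (\<lambda>n. u) u"
      by (simp add: L2_tendsto_def L2_norm_def)
    show "limsup (\<lambda>n. penalized_energy \<Omega> \<phi> (\<epsilon> n) u) \<le> constrained_energy \<Omega> \<phi> u"
    proof (cases "u \<in> segregated \<Omega> \<phi>")
      case True
      then show ?thesis by (simp add: penalized_energy_segregated Limsup_const)
    next
      case False
      then show ?thesis by (simp add: constrained_energy_def)
    qed
  qed (use u in simp)
qed

end
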